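(* Let $h\in L^*$ have coordinates $(h_1,\dots,h_8)$, and denote $$\Delta = h_6h_8-h_7^2,\qquad \Delta_1 = h_5h_7-h_4h_8,\qquad \Delta_2 = h_5h_6-h_4h_7.$$ (1) The co-adjoint orbit $\{\mathrm{Ad}^*_{q^{-1}}(h)\mid q\in G\}$ coincides with the orbit $O_h$ of the vector fields \begin{align*} V_1&=-h_3\frac{\partial}{\partial h_2}-h_4\frac{\partial}{\partial h_3}-h_6\frac{\partial}{\partial h_4}-h_7\frac{\partial}{\partial h_5},\\ V_2&=h_3\frac{\partial}{\partial h_1}-h_5\frac{\partial}{\partial h_3}-h_7\frac{\partial}{\partial h_4}-h_8\frac{\partial}{\partial h_5},\\ V_3&=h_4\frac{\partial}{\partial h_1}+h_5\frac{\partial}{\partial h_2},\qquad V_4=h_6\frac{\partial}{\partial h_1}+h_7\frac{\partial}{\partial h_2},\qquad V_5=h_7\frac{\partial}{\partial h_1}+h_8\frac{\partial}{\partial h_2} \end{align*} on $L^*$ through the point $h$. (2) The orbits $O_h$ have the following dimensions: (2.1) if $\Delta^2+\Delta_1^2+\Delta_2^2\neq0$, then $\dim O_h=4$; (2.2) if $\Delta^2+\Delta_1^2+\Delta_2^2=0$ and $h_3^2+\dots+h_8^2\neq0$, then $\dim O_h=2$; (2.3) if $h_3^2+\dots+h_8^2=0$, then $\dim O_h=0$. (3) If $\Delta\neq0$, then, with $C=h_5^2h_6-2h_4h_5h_7+h_4^2h_8-2h_3(h_6h_8-h_7^2)$ evaluated at $h$, $$O_h=\mathbb{R}^2_{h_1',h_2'}\times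 Q,\qquad Q=\Big\{(h_3',h_4',h_5')\in\mathbb{R}^3\ \Big|\ h_3'=\frac{h_6(h_5')^2-2h_7h_4'h_5'+h_8(h_4')^2-C}{2\Delta}\Big\},$$ where $(h_1',\dots,h_8')$ are the coordinates of a point of $O_h$ and $h_i'=h_i$ for $i=6,7,8$.
   Context: $L$ is the real 8-dimensional Lie algebra with basis $X_1,\dots,X_8$ and brackets $[X_1,X_2]=X_3$, $[X_1,X_3]=X_4$, $[X_2,X_3]=X_5$, $[X_1,X_4]=X_6$, $[X_1,X_5]=[X_2,X_4]=X_7$, $[X_2,X_5]=X_8$, all other brackets $[X_i,X_j]$ with $i<j$ being zero. $G$ is the connected simply connected Lie group with Lie algebra $L$. $L^*$ is the dual space of $L$, with linear coordinates $h_i(\lambda)=\langle\lambda,X_i\rangle$, $i=1,\dots,8$, and $G$ acts on $L^*$ by the co-adjoint action $h\mapsto\mathrm{Ad}^*_{q^{-1}}(h)$. The orbit $O_h$ of the vector fields $V_1,\dots,V_5$ through $h$ is the set of all points $e^{t_kV_{i_k}}\circ\cdots\circ e^{t_1V_{i_1}}(h)$ with $k\in\mathbb{N}$, $t_j\in\mathbb{R}$, $i_j\in\{1,\dots,5\}$, where $e^{tV}$ denotes the flow of $V$. It is an immersed submanifold of $L^*$, and $\dim O_h$ is its dimension. *)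

theory Defs
  imports "HOL-Analysis.Analysis"
begin

section \<open>Coordinates on an eight-dimensional space\<close>

lemma exhaust_8:
  fixes x :: 8
  shows "x = 1 \<or> x = 2 \<or> x = 3 \<or> x = 4 \<or> x = 5 \<or> x = 6 \<or> x = 7 \<or> x = 8"
proof (induct x)
  case (of_int z)
  then have "z = 0 \<or> z = 1 \<or> z = 2 \<or> z = 3 \<or> z = 4 \<or> z = 5 \<or> z = 6 \<or> z = 7" by fastforce
  then show ?case by auto
qed

lemma forall_8:
  "(\<forall>i::8. P i) \<longleftrightarrow> P 1 \<and> P 2 \<and> P 3 \<and> P 4 \<and> P 5 \<and> P 6 \<and> P 7 \<and> P 8"
  by (metis exhaust_8)

abbreviation E :: "8 \<Rightarrow> real^8" where
  "E i \<equiv> axis i 1"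

lemma E_nth: "E i $ j = (if j = i then 1 else 0)"
  by (auto simp: axis_def)


section \<open>The Lie algebra and its simply connected group\<close>

text \<open>The Lie algebra \<open>L\<close> is \<^typ>\<open>real^8\<close>, the basis vector \<open>X\<^sub>i\<close> being \<open>E i\<close>.\<close>

definition bracket :: "real^8 \<Rightarrow> real^8 \<Rightarrow> real^8" where
  "bracket x y =
     (x$1 * y$2 - x$2 * y$1) *\<^sub>R E 3
   + (x$1 * y$3 - x$3 * y$1) *\<^sub>R E 4
   + (x$2 * y$3 - x$3 * y$2) *\<^sub>R E 5
   + (x$1 * y$4 - x$4 * y$1) *\<^sub>R E 6
   + ((x$1 * y$5 - x$5 * y$1) + (x$2 * y$4 - x$4 * y$2)) *\<^sub>R E 7
   + (x$2 * y$5 - x$5 * y$2) *\<^sub>R E 8"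

lemma bracket_nth [simp]:
  "bracket x y $ 1 = 0"
  "bracket x y $ 2 = 0"
  "bracket x y $ 3 = x$1 * y$2 - x$2 * y$1"
  "bracket x y $ 4 = x$1 * y$3 - x$3 * y$1"
  "bracket x y $ 5 = x$2 * y$3 - x$3 * y$2"
  "bracket x y $ 6 = x$1 * y$4 - x$4 * y$1"
  "bracket x y $ 7 = (x$1 * y$5 - x$5 * y$1) + (x$2 * y$4 - x$4 * y$2)"
  "bracket x y $ 8 = x$2 * y$5 - x$5 * y$2"
  by (simp_all add: bracket_def E_nth)

lemma bracket_basis:
  "bracket (E 1) (E 2) = E 3"
  "bracket (E 1) (E 3) = E 4"
  "bracket (E 2) (E 3) = E 5"
  "bracket (E 1) (E 4) = E 6"
  "bracket (E 1) (E 5) = E 7"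
  "bracket (E 2) (E 4) = E 7"
  "bracket (E 2) (E 5) = E 8"
  "bracket (E 1) (E 6) = 0" "bracket (E 1) (E 7) = 0" "bracket (E 1) (E 8) = 0"
  "bracket (E 2) (E 6) = 0" "bracket (E 2) (E 7) = 0" "bracket (E 2) (E 8) = 0"
  "i \<in> {3,4,5,6,7,8} \<Longrightarrow> j \<in> {3,4,5,6,7,8} \<Longrightarrow> bracket (E i) (E j) = 0"
  by (auto simp: vec_eq_iff forall_8 E_nth)

lemma bilinear_bracket: "bilinear bracket"
  unfolding bilinear_def
  by (auto intro!: linearI simp: vec_eq_iff forall_8 algebra_simps)

lemma bracket_self: "bracket x x = 0"
  by (simp add: vec_eq_iff forall_8)

lemma bracket_jacobi:
  "bracket x (bracket y z) + bracket y (bracket z x) + bracket z (bracket x y) = 0"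
  by (simp add: vec_eq_iff forall_8 algebra_simps)

text \<open>
  Since \<open>L\<close> is nilpotent of step four, its connected simply connected Lie group \<open>G\<close> is the
  space \<open>L\<close> itself (the exponential map being the identity of \<open>L\<close>) with the
  Baker--Campbell--Hausdorff multiplication, whose series ends with the brackets of length four.
\<close>

definition gmult :: "real^8 \<Rightarrow> real^8 \<Rightarrow> real^8" where
  "gmult x y = x + y + (1/2) *\<^sub>R bracket x y
     + (1/12) *\<^sub>R bracket x (bracket x y)
     + (1/12) *\<^sub>R bracket y (bracket y x)
     - (1/24) *\<^sub>R bracket y (bracket x (bracket x y))"

definition ginv :: "real^8 \<Rightarrow> real^8" where
  "ginv x = - x"

lemma gmult_assoc: "gmult (gmult x y) z = gmult x (gmult y z)"
  by (simp add: gmult_def vec_eq_iff forall_8 field_simps)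

lemma gmult_0: "gmult 0 x = x" "gmult x 0 = x"
  by (simp_all add: gmult_def vec_eq_iff forall_8)

lemma gmult_ginv: "gmult (ginv x) x = 0" "gmult x (ginv x) = 0"
  by (simp_all add: gmult_def ginv_def vec_eq_iff forall_8 algebra_simps)

lemma gmult_one_parameter: "gmult (s *\<^sub>R x) (t *\<^sub>R x) = (s + t) *\<^sub>R x"
  by (simp add: gmult_def vec_eq_iff forall_8 algebra_simps)

text \<open>The tangent space of \<open>G\<close> at its identity \<open>0\<close> is \<open>L\<close>.\<close>

definition Ad :: "real^8 \<Rightarrow> real^8 \<Rightarrow> real^8" where
  "Ad q = frechet_derivative (\<lambda>x. gmult (gmult q x) (ginv q)) (at 0)"

lemma gmult_conj:
  "gmult (gmult q x) (ginv q) = x + bracket q x + (1/2) *\<^sub>R bracket q (bracket q x)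
     + (1/6) *\<^sub>R bracket q (bracket q (bracket q x))"
  by (simp add: gmult_def ginv_def vec_eq_iff forall_8 field_simps)

lemma linear_gmult_conj: "linear (\<lambda>x. gmult (gmult q x) (ginv q))"
  unfolding gmult_conj
  by (auto intro!: linearI simp: vec_eq_iff forall_8 field_simps)

lemma Ad_eq: "Ad q = (\<lambda>x. gmult (gmult q x) (ginv q))"
  unfolding Ad_def
  by (rule frechet_derivative_at[symmetric])
     (simp add: linear_gmult_conj linear_imp_has_derivative)

text \<open>The Lie algebra of \<open>G\<close> is \<open>L\<close>: the differential of \<open>Ad\<close> at the identity is \<open>ad\<close>.\<close>

lemma Ad_has_vector_derivative:
  "((\<lambda>t. Ad (t *\<^sub>R x) y) has_vector_derivative bracket x y) (at 0)"
proof -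
  have "Ad (t *\<^sub>R x) y = y + t *\<^sub>R bracket x y + (t\<^sup>2/2) *\<^sub>R bracket x (bracket x y)
     + (t^3/6) *\<^sub>R bracket x (bracket x (bracket x y))" for t
    unfolding Ad_eq gmult_conj
    by (simp add: vec_eq_iff forall_8 field_simps power2_eq_square power3_eq_cube)
  then show ?thesis
    by (auto intro!: derivative_eq_intros simp: has_vector_derivative_def)
qed


section \<open>The co-adjoint action\<close>

text \<open>
  A functional \<open>\<lambda>\<close> in the dual space of \<open>L\<close> is given by its coordinates \<open>h\<^sub>i = \<lambda>(X\<^sub>i)\<close>, so that
  it is a vector \<open>h :: real^8\<close> acting by \<open>x \<mapsto> h \<bullet> x\<close>, and \<open>Ad\<^sup>*\<^sub>q\<close>, the dual of
  \<open>Ad\<^sub>q\<close>, is given by \<^const>\<open>adjoint\<close>.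
\<close>

definition coAd :: "real^8 \<Rightarrow> real^8 \<Rightarrow> real^8" where
  "coAd q = adjoint (Ad q)"

lemma inner_coAd: "coAd q h \<bullet> x = h \<bullet> Ad q x"
  unfolding coAd_def
  by (simp add: adjoint_works linear_gmult_conj Ad_eq inner_commute)

definition coadjoint_orbit :: "real^8 \<Rightarrow> (real^8) set" where
  "coadjoint_orbit h = {coAd (ginv q) h | q. True}"


section \<open>Orbits of vector fields\<close>

definition complete_integral_curve :: "('a \<Rightarrow> 'a) \<Rightarrow> 'a \<Rightarrow> (real \<Rightarrow> 'a::real_normed_vector) \<Rightarrow> bool" where
  "complete_integral_curve V x \<gamma> \<longleftrightarrow>
     \<gamma> 0 = x \<and> (\<forall>t. (\<gamma> has_vector_derivative V (\<gamma> t)) (at t))"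

text \<open>\<open>flow V t\<close> is \<open>e\<^sup>t\<^sup>V\<close>; it is meaningful for a complete vector field with unique
  integral curves.\<close>

definition flow :: "('a \<Rightarrow> 'a) \<Rightarrow> real \<Rightarrow> 'a \<Rightarrow> 'a::real_normed_vector" where
  "flow V t x = (THE \<gamma>. complete_integral_curve V x \<gamma>) t"

definition orbit :: "('a \<Rightarrow> 'a) set \<Rightarrow> 'a \<Rightarrow> 'a::real_normed_vector set" where
  "orbit F x = {fold (\<lambda>(t, V). flow V t) l x | l. set l \<subseteq> UNIV \<times> F}"

definition V1 :: "real^8 \<Rightarrow> real^8" where
  "V1 h = - (h$3) *\<^sub>R E 2 - (h$4) *\<^sub>R E 3 - (h$6) *\<^sub>R E 4 - (h$7) *\<^sub>R E 5"

definition V2 :: "real^8 \<Rightarrow> real^8" where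
  "V2 h = (h$3) *\<^sub>R E 1 - (h$5) *\<^sub>R E 3 - (h$7) *\<^sub>R E 4 - (h$8) *\<^sub>R E 5"

definition V3 :: "real^8 \<Rightarrow> real^8" where
  "V3 h = (h$4) *\<^sub>R E 1 + (h$5) *\<^sub>R E 2"

definition V4 :: "real^8 \<Rightarrow> real^8" where
  "V4 h = (h$6) *\<^sub>R E 1 + (h$7) *\<^sub>R E 2"

definition V5 :: "real^8 \<Rightarrow> real^8" where
  "V5 h = (h$7) *\<^sub>R E 1 + (h$8) *\<^sub>R E 2"

abbreviation coadjoint_fields :: "(real^8 \<Rightarrow> real^8) set" where
  "coadjoint_fields \<equiv> {V1, V2, V3, V4, V5}"

lemma V_nth:
  "V1 h $ i = (if i = 2 then - h$3 else if i = 3 then - h$4 else if i = 4 then - h$6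
     else if i = 5 then - h$7 else 0)"
  "V2 h $ i = (if i = 1 then h$3 else if i = 3 then - h$5 else if i = 4 then - h$7
     else if i = 5 then - h$8 else 0)"
  "V3 h $ i = (if i = 1 then h$4 else if i = 2 then h$5 else 0)"
  "V4 h $ i = (if i = 1 then h$6 else if i = 2 then h$7 else 0)"
  "V5 h $ i = (if i = 1 then h$7 else if i = 2 then h$8 else 0)"
  by (auto simp: V1_def V2_def V3_def V4_def V5_def E_nth)

lemma complete_integral_curve_nth:
  fixes \<gamma> :: "real \<Rightarrow> real^8"
  shows "complete_integral_curve V x \<gamma> \<longleftrightarrow>
     (\<forall>i. \<gamma> 0 $ i = x $ i \<and> (\<forall>t. ((\<lambda>t. \<gamma> t $ i) has_real_derivative V (\<gamma> t) $ i) (at t)))"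
proof -
  have "(\<gamma> has_vector_derivative v) (at t) \<longleftrightarrow>
      (\<forall>i. ((\<lambda>t. \<gamma> t $ i) has_real_derivative v $ i) (at t))" for v t
    unfolding has_vector_derivative_def has_field_derivative_def
      has_derivative_componentwise_within[of \<gamma>]
    by (simp add: Basis_vec_def inner_axis mult.commute mult_commute_abs)
  then show ?thesis
    unfolding complete_integral_curve_def by (auto simp: vec_eq_iff)
qed

lemma eq_if_same_derivative:
  fixes f g :: "real \<Rightarrow> real"
  assumes "\<And>t. (f has_real_derivative D t) (at t)" "\<And>t. (g has_real_derivative D t) (at t)"
    and "f 0 = g 0"
  shows "f = g"
proof
  fix t
  have "((\<lambda>t. f t - g t) has_real_derivative 0) (at s)" for s
    using DERIV_diff[OF assms(1)[of s] assms(2)[of s]] by simp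
  then have "f t - g t = f 0 - g 0"
    using DERIV_isconst_all by blast
  then show "f t = g t" using assms(3) by simp
qed

lemma complete_integral_curve_unique:
  assumes V: "V \<in> coadjoint_fields"
    and \<gamma>: "complete_integral_curve V x \<gamma>" and \<delta>: "complete_integral_curve V x \<delta>"
  shows "\<gamma> = \<delta>"
proof -
  have step: "(\<lambda>t. \<gamma> t $ i) = (\<lambda>t. \<delta> t $ i)" if "\<And>t. V (\<gamma> t) $ i = V (\<delta> t) $ i" for i
    by (rule eq_if_same_derivative[where D = "\<lambda>t. V (\<delta> t) $ i"])
       (use \<gamma> \<delta> that in \<open>metis complete_integral_curve_nth\<close>)+
  have step': "\<gamma> t $ i = \<delta> t $ i" if "\<And>t. V (\<gamma> t) $ i = V (\<delta> t) $ i" for i t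
    using step[OF that] by (auto dest: fun_cong)
  have c678: "\<gamma> t $ 6 = \<delta> t $ 6" "\<gamma> t $ 7 = \<delta> t $ 7" "\<gamma> t $ 8 = \<delta> t $ 8" for t
    using V by (auto intro!: step' simp: V_nth)
  have c45: "\<gamma> t $ 4 = \<delta> t $ 4" "\<gamma> t $ 5 = \<delta> t $ 5" for t
    using V by (auto intro!: step' simp: V_nth c678)
  have c3: "\<gamma> t $ 3 = \<delta> t $ 3" for t
    using V by (auto intro!: step' simp: V_nth c45)
  have "\<gamma> t $ 1 = \<delta> t $ 1" "\<gamma> t $ 2 = \<delta> t $ 2" for t
    using V by (auto intro!: step' simp: V_nth c678 c45 c3)
  then show ?thesis
    by (auto simp: fun_eq_iff vec_eq_iff forall_8 c678 c45 c3)
qed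

lemma complete_integral_curve_exists:
  assumes "V \<in> coadjoint_fields"
  shows "\<exists>\<gamma>. complete_integral_curve V x \<gamma>"
proof -
  have 1: "complete_integral_curve V1 x (\<lambda>t. \<chi> i. 
     if i = 2 then x$2 - t * x$3 + t^2 / 2 * x$4 - t^3 / 6 * x$6
     else if i = 3 then x$3 - t * x$4 + t^2 / 2 * x$6
     else if i = 4 then x$4 - t * x$6 else if i = 5 then x$5 - t * x$7 else x$i)"
    unfolding complete_integral_curve_nth forall_8
    by (auto intro!: derivative_eq_intros simp: V_nth)
  have 2: "complete_integral_curve V2 x (\<lambda>t. \<chi> i. 
     if i = 1 then x$1 + t * x$3 - t^2 / 2 * x$5 + t^3 / 6 * x$8
     else if i = 3 then x$3 - t * x$5 + t^2 / 2 * x$8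
     else if i = 4 then x$4 - t * x$7 else if i = 5 then x$5 - t * x$8 else x$i)"
    unfolding complete_integral_curve_nth forall_8
    by (auto intro!: derivative_eq_intros simp: V_nth)
  have 3: "complete_integral_curve V x (\<lambda>t. x + t *\<^sub>R V x)" if "V \<in> {V3, V4, V5}" for V
    using that unfolding complete_integral_curve_nth forall_8
    by (auto intro!: derivative_eq_intros simp: V_nth)
  show ?thesis using assms 1 2 3 by blast
qed

lemma flow_complete_integral_curve:
  assumes "V \<in> coadjoint_fields"
  shows "complete_integral_curve V x (\<lambda>t. flow V t x)"
  unfolding flow_def using complete_integral_curve_exists[OF assms]
  by (metis (no_types, lifting) complete_integral_curve_unique[OF assms] theI)


section \<open>Smooth maps and immersed submanifolds\<close>

primrec C_k_on :: "nat \<Rightarrow> 'a set \<Rightarrow> ('a::euclidean_space \<Rightarrow> 'b::euclidean_space) \<Rightarrow> bool" where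
  "C_k_on 0 S f \<longleftrightarrow> continuous_on S f"
| "C_k_on (Suc k) S f \<longleftrightarrow>
     (\<forall>x\<in>S. f differentiable at x) \<and> (\<forall>v. C_k_on k S (\<lambda>x. frechet_derivative f (at x) v))"

text \<open>To be used on open sets only.\<close>

definition smooth_on :: "'a set \<Rightarrow> ('a::euclidean_space \<Rightarrow> 'b::euclidean_space) \<Rightarrow> bool" where
  "smooth_on S f \<longleftrightarrow> (\<forall>k. C_k_on k S f)"

lemma C_k_on_cong:
  assumes "open S" "\<And>x. x \<in> S \<Longrightarrow> f x = g x" "C_k_on k S f"
  shows "C_k_on k S g"
  using assms(2,3)
proof (induction k arbitrary: f g)
  case 0
  then show ?case using continuous_on_cong by fastforce
next
  case (Suc k)
  have *: "(g has_derivative frechet_derivative f (at x)) (at x)" if "x \<in> S" for x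
    using Suc.prems that assms(1)
    by (metis C_k_on.simps(2) frechet_derivative_works has_derivative_transform_within_open)
  then have **: "frechet_derivative g (at x) = frechet_derivative f (at x)" if "x \<in> S" for x
    using that by (metis frechet_derivative_at)
  have "C_k_on k S (\<lambda>x. frechet_derivative g (at x) v)" for v
    using Suc.IH[of "\<lambda>x. frechet_derivative f (at x) v" "\<lambda>x. frechet_derivative g (at x) v"]
      Suc.prems(2) ** by simp
  then show ?case using * by (auto simp: differentiable_def)
qed

lemma C_k_on_SucD: "C_k_on (Suc k) S f \<Longrightarrow> C_k_on k S f"
  by (induction k arbitrary: f)
     (auto intro!: differentiable_imp_continuous_on
        simp: differentiable_on_def differentiable_at_withinI)

lemma C_k_on_const: "C_k_on k S (\<lambda>x. c)"
  by (induction k arbitrary: c) auto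

lemma C_k_on_bounded_linear: "bounded_linear f \<Longrightarrow> C_k_on k S f"
proof (cases k)
  case (Suc k')
  assume f: "bounded_linear f"
  then have "frechet_derivative f (at x) = f" for x
    by (metis bounded_linear_imp_has_derivative frechet_derivative_at)
  then show ?thesis using f Suc
    by (auto simp: C_k_on_const bounded_linear_imp_differentiable)
qed (simp add: linear_continuous_on)

lemma C_k_on_SucI:
  assumes "open S" "\<And>x. x \<in> S \<Longrightarrow> (f has_derivative f' x) (at x)" "\<And>v. C_k_on k S (\<lambda>x. f' x v)"
  shows "C_k_on (Suc k) S f"
proof -
  have "C_k_on k S (\<lambda>x. frechet_derivative f (at x) v)" for v
    by (rule C_k_on_cong[OF assms(1) _ assms(3)[of v]]) (metis assms(2) frechet_derivative_at)
  then show ?thesis using assms(2) by (auto simp: differentiable_def)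
qed

lemma C_k_on_SucE:
  assumes "C_k_on (Suc k) S f" "x \<in> S"
  shows "(f has_derivative frechet_derivative f (at x)) (at x)"
  using assms by (auto simp: frechet_derivative_works)

lemma C_k_on_add:
  assumes S: "open S"
  shows "C_k_on k S f \<Longrightarrow> C_k_on k S g \<Longrightarrow> C_k_on k S (\<lambda>x. f x + g x)"
proof (induction k arbitrary: f g)
  case (Suc k)
  show ?case
    by (rule C_k_on_SucI[OF S has_derivative_add[OF C_k_on_SucE[OF Suc.prems(1)] C_k_on_SucE[OF Suc.prems(2)]]])
       (use Suc in auto)
qed (auto intro: continuous_intros)

lemma C_k_on_mult:
  fixes f g :: "'a::euclidean_space \<Rightarrow> real"
  assumes S: "open S"
  shows "C_k_on k S f \<Longrightarrow> C_k_on k S g \<Longrightarrow> C_k_on k S (\<lambda>x. f x * g x)"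
proof (induction k arbitrary: f g)
  case (Suc k)
  have "C_k_on k S f" "C_k_on k S g"
    using Suc.prems by (auto intro: C_k_on_SucD)
  then show ?case
    by (intro C_k_on_SucI[OF S has_derivative_mult[OF C_k_on_SucE[OF Suc.prems(1)] C_k_on_SucE[OF Suc.prems(2)]]])
       (use Suc in \<open>auto intro!: C_k_on_add S Suc.IH\<close>)
qed (auto intro: continuous_intros)

lemma C_k_on_compose_bounded_linear:
  assumes S: "open S" and L: "bounded_linear L"
  shows "C_k_on k S f \<Longrightarrow> C_k_on k S (\<lambda>x. L (f x))"
proof (induction k arbitrary: f)
  case 0
  then show ?case
    using bounded_linear.continuous_on[OF L] by simp
next
  case (Suc k)
  show ?case
    by (rule C_k_on_SucI[OF S bounded_linear.has_derivative[OF L C_k_on_SucE[OF Suc.prems]]])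
       (use Suc in auto)
qed

lemma C_k_on_sum:
  assumes "open S" "\<And>i. i \<in> I \<Longrightarrow> C_k_on k S (f i)"
  shows "C_k_on k S (\<lambda>x. \<Sum>i\<in>I. f i x)"
  using assms(2)
  by (induction I rule: infinite_finite_induct) (auto intro!: C_k_on_add[OF assms(1)] C_k_on_const)

lemma smooth_on_vec:
  fixes f :: "'a::euclidean_space \<Rightarrow> real^'n"
  assumes "open S" "\<And>i. smooth_on S (\<lambda>x. f x $ i)"
  shows "smooth_on S f"
proof -
  have "C_k_on k S (\<lambda>x. \<Sum>i\<in>UNIV. f x $ i *\<^sub>R axis i (1::real))" for k
    using assms unfolding smooth_on_def
    by (intro C_k_on_sum C_k_on_compose_bounded_linear[OF _ bounded_linear_scaleR_left]) auto
  moreover have "(\<lambda>x. \<Sum>i\<in>UNIV. f x $ i *\<^sub>R axis i (1::real)) = f"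
    by (simp add: basis_expansion flip: scalar_mult_eq_scaleR)
  ultimately show ?thesis by (simp add: smooth_on_def)
qed

lemma smooth_on_add:
  "open S \<Longrightarrow> smooth_on S f \<Longrightarrow> smooth_on S g \<Longrightarrow> smooth_on S (\<lambda>x. f x + g x)"
  by (simp add: smooth_on_def C_k_on_add)

lemma smooth_on_mult:
  fixes f g :: "'a::euclidean_space \<Rightarrow> real"
  shows "open S \<Longrightarrow> smooth_on S f \<Longrightarrow> smooth_on S g \<Longrightarrow> smooth_on S (\<lambda>x. f x * g x)"
  by (simp add: smooth_on_def C_k_on_mult)

lemma smooth_on_const: "smooth_on S (\<lambda>x. c)"
  by (simp add: smooth_on_def C_k_on_const)

lemma smooth_on_bounded_linear: "bounded_linear f \<Longrightarrow> smooth_on S f"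
  by (simp add: smooth_on_def C_k_on_bounded_linear)

lemma smooth_on_diff:
  fixes f g :: "'a::euclidean_space \<Rightarrow> real"
  assumes "open S" "smooth_on S f" "smooth_on S g"
  shows "smooth_on S (\<lambda>x. f x - g x)"
  using smooth_on_add[OF assms(1,2) smooth_on_mult[OF assms(1) smooth_on_const[of S "-1"] assms(3)]]
  by simp

lemma smooth_on_divide_const:
  fixes f :: "'a::euclidean_space \<Rightarrow> real"
  shows "open S \<Longrightarrow> smooth_on S f \<Longrightarrow> smooth_on S (\<lambda>x. f x / c)"
  using smooth_on_mult[of S f "\<lambda>x. 1 / c"] by (simp add: smooth_on_const)

lemma smooth_gmult: "smooth_on UNIV (\<lambda>(x, y). gmult x y)"
proof -
  have coord: "smooth_on UNIV (\<lambda>p::(real^8) \<times> (real^8). fst p $ i)"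
              "smooth_on UNIV (\<lambda>p::(real^8) \<times> (real^8). snd p $ i)" for i
    by (auto intro!: smooth_on_bounded_linear bounded_linear_compose[OF bounded_linear_vec_nth]
        bounded_linear_fst bounded_linear_snd)
  have "smooth_on UNIV (\<lambda>p. gmult (fst p) (snd p) $ i)" for i
    using exhaust_8[of i]
    by (elim disjE)
       (simp_all add: gmult_def,
        (intro smooth_on_add smooth_on_diff smooth_on_mult smooth_on_divide_const coord open_UNIV)+)
  then show ?thesis
    by (auto intro!: smooth_on_vec simp: case_prod_unfold)
qed

lemma smooth_ginv: "smooth_on UNIV ginv"
  unfolding ginv_def by (intro smooth_on_bounded_linear bounded_linear_minus bounded_linear_ident)

text \<open>Embedded submanifolds are described by slice charts.\<close>

definition embedded_submanifold :: "nat \<Rightarrow> 'a::euclidean_space set \<Rightarrow> bool" where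
  "embedded_submanifold d N \<longleftrightarrow>
     (\<forall>p\<in>N. \<exists>(U::'a set) (V::'a set) \<phi> \<psi> W.
        open U \<and> p \<in> U \<and> open V \<and> homeomorphism U V \<phi> \<psi> \<and> smooth_on U \<phi> \<and> smooth_on V \<psi> \<and>
        subspace W \<and> dim W = d \<and> \<phi> ` (U \<inter> N) = V \<inter> W)"

text \<open>
  The immersed submanifolds of dimension \<open>d\<close> are the images of injective immersions of
  \<open>d\<close>-dimensional manifolds. Transporting the topology \<open>T\<close> of the manifold to its image \<open>M\<close>,
  such an immersion is given by a topology on \<open>M\<close>, in general finer than the subspace topology,
  in which each point has an open neighbourhood that is an embedded submanifold carrying the subspace
  topology. The topology \<open>T\<close> of a manifold is second countable, which makes \<open>d\<close> unique for
  nonempty \<open>M\<close>.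
\<close>

definition immersed_submanifold :: "nat \<Rightarrow> 'a::euclidean_space set \<Rightarrow> bool" where
  "immersed_submanifold d M \<longleftrightarrow>
     (\<exists>T. topspace T = M \<and> second_countable T \<and>
        (\<forall>p\<in>M. \<exists>N. openin T N \<and> p \<in> N \<and> subtopology T N = top_of_set N \<and>
           embedded_submanifold d N))"

end

theory Submission
  imports Defs
begin

text \<open>
  Every \<open>V\<^sub>i\<close> is the fundamental field of the basis vector \<open>X\<^sub>i\<close> under the co-adjoint action, so its
  flow is the action of a one-parameter subgroup (\<open>flow_eq_coAd\<close>). Modulo the centre, spanned by
  \<open>X\<^sub>6, X\<^sub>7, X\<^sub>8\<close>, every element of \<open>G\<close> is a product of elements of the subgroups of
  \<open>X\<^sub>1, \<dots>, X\<^sub>5\<close> (\<open>coAd_ginv_eq_flows\<close>); as the centre acts trivially, the two orbits coincide.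

  For the dimensions, each orbit is determined explicitly as the common level set of polynomial
  invariants: the flows, which are polynomial, preserve these functions, and conversely suitable
  flow times carry \<open>h\<close> to any given point of the level set. The coordinates \<open>h\<^sub>6, h\<^sub>7, h\<^sub>8\<close> are
  always invariant. They form a symmetric matrix \<open>(h\<^sub>6 h\<^sub>7; h\<^sub>7 h\<^sub>8)\<close> of determinant \<open>\<Delta>\<close>, whose rows
  are, up to sign, the directions in which \<open>V1, V2\<close> move \<open>(h\<^sub>4, h\<^sub>5)\<close> and \<open>V4, V5\<close> move \<open>(h\<^sub>1, h\<^sub>2)\<close>. Its rank
  separates the cases.

  \<^item> Rank two (\<open>orbit_nondegenerate\<close>): one further invariant, of degree one in \<open>h\<^sub>3\<close>; the orbit is a graph
    of \<open>h\<^sub>3\<close> over four free coordinates, as in the last claim of the theorem.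
  \<^item> Rank one: the matrix is \<open>s\<close> times the projection onto the line of a unit vector \<open>(u, v)\<close>, and
    \<open>\<Delta>\<^sub>1, \<Delta>\<^sub>2\<close> are \<open>s v\<close> and \<open>s u\<close> times the component \<open>u h\<^sub>5 - v h\<^sub>4\<close> of \<open>(h\<^sub>4, h\<^sub>5)\<close> transverse to it,
    which is invariant. If it is nonzero, the orbit is a four-dimensional affine subspace
    (\<open>orbit_transverse\<close>). If it is zero, two more invariants leave only the
    components of \<open>(h\<^sub>1, h\<^sub>2)\<close> and \<open>(h\<^sub>4, h\<^sub>5)\<close> along \<open>(u, v)\<close> free (\<open>orbit_parallel\<close>).
  \<^item> Rank zero: then \<open>\<Delta> = \<Delta>\<^sub>1 = \<Delta>\<^sub>2 = 0\<close>, and \<open>h\<close> comes from a quotient of \<open>L\<close> of smaller step. The orbit is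
    a parabolic cylinder (\<open>orbit_step_three\<close>), a plane (\<open>orbit_step_two\<close>) or a
    point (\<open>orbit_fixed_point\<close>).

  In every case the orbit is the graph of a polynomial map over a linear subspace, after
  a rotation adapted to \<open>(u, v)\<close>. Such a graph is flattened by a global polynomial shear
  (\<open>embedded_submanifold_shear\<close>), and so is even an embedded submanifold, of the dimension of the
  subspace.
\<close>

section \<open>Orbits of a family of vector fields\<close>

lemma orbit_refl: "x \<in> orbit F x"
  unfolding orbit_def by (auto intro!: exI[of _ "[]"])

lemma orbit_flow:
  assumes "y \<in> orbit F x" "V \<in> F"
  shows "flow V t y \<in> orbit F x"
proof -
  obtain l where "y = fold (\<lambda>(t, V). flow V t) l x" "set l \<subseteq> UNIV \<times> F"
    using assms(1) unfolding orbit_def by auto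
  then show ?thesis unfolding orbit_def using assms(2)
    by (auto intro!: exI[of _ "l @ [(t, V)]"])
qed

lemma orbit_subset:
  assumes "x \<in> S" "\<And>y V t. y \<in> S \<Longrightarrow> V \<in> F \<Longrightarrow> flow V t y \<in> S"
  shows "orbit F x \<subseteq> S"
proof -
  have "fold (\<lambda>(t, V). flow V t) l y \<in> S" if "set l \<subseteq> UNIV \<times> F" "y \<in> S" for l y
    using that by (induction l arbitrary: y) (auto intro: assms(2))
  then show ?thesis using assms(1) unfolding orbit_def by blast
qed

lemma orbit_eqI:
  assumes "x \<in> S" "\<And>y V t. y \<in> S \<Longrightarrow> V \<in> F \<Longrightarrow> flow V t y \<in> S" "\<And>y. y \<in> S \<Longrightarrow> y \<in> orbit F x"
  shows "orbit F x = S"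
  using orbit_subset[OF assms(1,2)] assms(3) by blast

section \<open>The flows of the fields\<close>

lemma flow_eqI:
  assumes "V \<in> coadjoint_fields" "complete_integral_curve V x \<gamma>"
  shows "flow V t x = \<gamma> t"
  using fun_cong[OF complete_integral_curve_unique[OF assms(1) flow_complete_integral_curve[OF assms(1)] assms(2)]]
  by simp

text \<open>
  As \<open>V1\<close> is triangular for the order 8, ..., 1 of the coordinates, its flow is obtained by successive
  integrations and is polynomial in the time; likewise for \<open>V2\<close>.
\<close>
lemma flow_V1: "flow V1 t x = (\<chi> i.
     if i = 2 then x$2 - t * x$3 + t^2 / 2 * x$4 - t^3 / 6 * x$6
     else if i = 3 then x$3 - t * x$4 + t^2 / 2 * x$6
     else if i = 4 then x$4 - t * x$6 else if i = 5 then x$5 - t * x$7 else x$i)"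
  by (rule flow_eqI[where \<gamma> = "\<lambda>t. \<chi> i.
     if i = 2 then x$2 - t * x$3 + t^2 / 2 * x$4 - t^3 / 6 * x$6
     else if i = 3 then x$3 - t * x$4 + t^2 / 2 * x$6
     else if i = 4 then x$4 - t * x$6 else if i = 5 then x$5 - t * x$7 else x$i"],
      simp, unfold complete_integral_curve_nth forall_8)
     (auto intro!: derivative_eq_intros simp: V_nth)

lemma flow_V2: "flow V2 t x = (\<chi> i.
     if i = 1 then x$1 + t * x$3 - t^2 / 2 * x$5 + t^3 / 6 * x$8
     else if i = 3 then x$3 - t * x$5 + t^2 / 2 * x$8
     else if i = 4 then x$4 - t * x$7 else if i = 5 then x$5 - t * x$8 else x$i)"
  by (rule flow_eqI[where \<gamma> = "\<lambda>t. \<chi> i.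
     if i = 1 then x$1 + t * x$3 - t^2 / 2 * x$5 + t^3 / 6 * x$8
     else if i = 3 then x$3 - t * x$5 + t^2 / 2 * x$8
     else if i = 4 then x$4 - t * x$7 else if i = 5 then x$5 - t * x$8 else x$i"],
      simp, unfold complete_integral_curve_nth forall_8)
     (auto intro!: derivative_eq_intros simp: V_nth)

text \<open>
  These three fields move only the first two coordinates, on which they do not depend.
\<close>
lemma flow_V345:
  assumes "V \<in> {V3, V4, V5}"
  shows "flow V t x = x + t *\<^sub>R V x"
  by (rule flow_eqI[where \<gamma> = "\<lambda>t. x + t *\<^sub>R V x"], use assms in blast,
      unfold complete_integral_curve_nth forall_8)
     (use assms in \<open>auto intro!: derivative_eq_intros simp: V_nth\<close>)

lemmas flow_fields = flow_V1 flow_V2 flow_V345[of V3, simplified] flow_V345[of V4, simplified]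
  flow_V345[of V5, simplified] V_nth

section \<open>The co-adjoint orbit as an orbit of the fields\<close>

lemma UNIV_8: "(UNIV :: 8 set) = {1, 2, 3, 4, 5, 6, 7, 8}"
  by (simp add: set_eq_iff forall_8)

lemma sum_8: "(\<Sum>i\<in>UNIV. f (i::8)) = f 1 + f 2 + f 3 + f 4 + f 5 + f 6 + f 7 + f 8"
  unfolding UNIV_8
  by ((subst sum.insert, simp, simp)+, simp only: sum.empty add.assoc add_0_right)

lemma coAd_nth: "coAd q h $ i = h \<bullet> Ad q (E i)"
  by (simp add: inner_coAd[symmetric] inner_axis)

lemma coAd_coords:
  "coAd q h $ i = (\<Sum>j\<in>UNIV. h $ j * (E i + bracket q (E i) + (1/2) *\<^sub>R bracket q (bracket q (E i))
     + (1/6) *\<^sub>R bracket q (bracket q (bracket q (E i)))) $ j)"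
  unfolding coAd_nth Ad_eq gmult_conj inner_vec_def inner_real_def ..

text \<open>
  The field \<open>V\<^sub>i\<close> is the fundamental vector field of \<open>X\<^sub>i\<close> for the co-adjoint action. As \<open>L\<close> is
  nilpotent, both sides are polynomial in the time, and expanding the coordinates decides the
  identity.
\<close>
lemma flow_eq_coAd:
  "flow V1 t x = coAd (ginv (t *\<^sub>R E 1)) x"
  "flow V2 t x = coAd (ginv (t *\<^sub>R E 2)) x"
  "flow V3 t x = coAd (ginv (t *\<^sub>R E 3)) x"
  "flow V4 t x = coAd (ginv (t *\<^sub>R E 4)) x"
  "flow V5 t x = coAd (ginv (t *\<^sub>R E 5)) x"
  by (simp_all add: vec_eq_iff forall_8 coAd_coords sum_8 flow_fields E_nth ginv_def field_simps
      power2_eq_square power3_eq_cube)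

lemma Ad_gmult: "Ad (gmult q p) x = Ad q (Ad p x)"
proof -
  have "ginv (gmult q p) = gmult (ginv p) (ginv q)"
    by (simp add: gmult_def ginv_def vec_eq_iff forall_8 field_simps)
  then show ?thesis by (simp add: Ad_eq gmult_assoc)
qed

text \<open>
  Dualizing the homomorphism \<^const>\<open>Ad\<close> reverses the order of the factors; the inverse in
  \<^const>\<open>coadjoint_orbit\<close> restores it.
\<close>
lemma coAd_gmult: "coAd p (coAd q h) = coAd (gmult q p) h"
  by (simp add: vec_eq_iff coAd_nth[of "gmult q p"] coAd_nth[of p] inner_coAd Ad_gmult)

text \<open>
  Up to a factor in the centre, which is spanned by \<open>X\<^sub>6, X\<^sub>7, X\<^sub>8\<close> and acts trivially on the
  dual, every group element is a product of one-parameter subgroups of \<open>X\<^sub>1, \<dots>, X\<^sub>5\<close> in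
  this order. The times are the solution of the triangular system that the
  Baker--Campbell--Hausdorff formula gives for the factors.
\<close>
lemma coAd_ginv_eq_flows:
  fixes q :: "real^8"
  defines "a \<equiv> q$3 + q$1 * q$2 / 2"
  shows "coAd (ginv q) h =
    flow V5 (q$5 + q$1 * (q$2)\<^sup>2 / 12 + q$2 * a / 2)
   (flow V4 (q$4 - (q$1)\<^sup>2 * q$2 / 12 + q$1 * a / 2)
   (flow V3 a (flow V2 (q$2) (flow V1 (q$1) h))))"
  unfolding a_def
  by (simp add: vec_eq_iff forall_8 coAd_coords sum_8 flow_fields E_nth ginv_def field_simps
      power2_eq_square power3_eq_cube)

lemma coadjoint_orbit_eq_orbit: "coadjoint_orbit h = orbit coadjoint_fields h"
proof
  show "orbit coadjoint_fields h \<subseteq> coadjoint_orbit h"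
  proof (rule orbit_subset)
    have "coAd (ginv 0) h = h"
      by (simp add: vec_eq_iff forall_8 coAd_coords sum_8 E_nth ginv_def)
    then show "h \<in> coadjoint_orbit h" unfolding coadjoint_orbit_def by (metis (mono_tags) mem_Collect_eq)
    fix y V and t :: real
    assume "y \<in> coadjoint_orbit h" and V: "V \<in> coadjoint_fields"
    then obtain q where q: "y = coAd (ginv q) h" unfolding coadjoint_orbit_def by auto
    obtain p where "flow V t y = coAd p y" using V flow_eq_coAd by blast
    then have "flow V t y = coAd (ginv (ginv (gmult (ginv q) p))) h"
      by (simp add: q coAd_gmult ginv_def)
    then show "flow V t y \<in> coadjoint_orbit h" unfolding coadjoint_orbit_def by blast
  qed
  show "coadjoint_orbit h \<subseteq> orbit coadjoint_fields h"
    by (auto simp: coadjoint_orbit_def coAd_ginv_eq_flows intro!: orbit_flow orbit_refl)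
qed

section \<open>Graphs over linear subspaces as submanifolds\<close>

text \<open>
  Orbits with \<open>\<Delta> = 0\<close> single out a direction \<open>(u, v)\<close>: that of the image of the matrix
  \<open>(h\<^sub>6 h\<^sub>7; h\<^sub>7 h\<^sub>8)\<close> or, if this vanishes, that of \<open>(h\<^sub>4, h\<^sub>5)\<close>, as long as one of them is nonzero.
  After the rotation, coordinates 1 and 4 are the components of \<open>(h\<^sub>1, h\<^sub>2)\<close> and \<open>(h\<^sub>4, h\<^sub>5)\<close> along
  \<open>(u, v)\<close>, and coordinates 2 and 5 the transverse ones.
\<close>
definition rotate_pairs :: "real \<Rightarrow> real \<Rightarrow> real^8 \<Rightarrow> real^8" where
  "rotate_pairs u v x = (\<chi> i. if i = 1 then u * x$1 + v * x$2 else if i = 2 then u * x$2 - v * x$1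
     else if i = 4 then u * x$4 + v * x$5 else if i = 5 then u * x$5 - v * x$4 else x$i)"

lemma linear_rotate_pairs: "linear (rotate_pairs u v)"
  by (auto intro!: linearI simp: rotate_pairs_def vec_eq_iff forall_8 algebra_simps)

lemma rotate_pairs_inverse:
  assumes "u\<^sup>2 + v\<^sup>2 = 1"
  shows "rotate_pairs u (- v) (rotate_pairs u v x) = x"
proof -
  have *: "u * (u * a) + v * (v * a) = a" for a
    using assms by (metis distrib_right mult.assoc mult_1 power2_eq_square)
  show ?thesis by (simp add: rotate_pairs_def vec_eq_iff forall_8 right_diff_distrib distrib_left
      *[of "x$1"] *[of "x$2"] *[of "x$4"] *[of "x$5"] mult.left_commute)
qed

lemma dim_rotate_pairs_vimage:
  assumes "u\<^sup>2 + v\<^sup>2 = 1"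
  shows "dim {w. \<forall>i. i \<notin> I \<longrightarrow> rotate_pairs u v w $ i = 0} = card I"
proof -
  let ?W = "{w::real^8. \<forall>i. i \<notin> I \<longrightarrow> w $ i = 0}"
  have inj: "inj (rotate_pairs u (- v))"
    using assms rotate_pairs_inverse[of u "- v"] by (metis inj_on_inverseI power2_minus)
  have "{w. \<forall>i. i \<notin> I \<longrightarrow> rotate_pairs u v w $ i = 0} = rotate_pairs u (- v) ` ?W"
  proof (intro equalityI subsetI)
    fix w assume "w \<in> {w. \<forall>i. i \<notin> I \<longrightarrow> rotate_pairs u v w $ i = 0}"
    then show "w \<in> rotate_pairs u (- v) ` ?W"
      using rotate_pairs_inverse[OF assms, of w] by (auto intro!: image_eqI[of _ _ "rotate_pairs u v w"])
  next
    fix w assume "w \<in> rotate_pairs u (- v) ` ?W"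
    then show "w \<in> {w. \<forall>i. i \<notin> I \<longrightarrow> rotate_pairs u v w $ i = 0}"
      using rotate_pairs_inverse[of u "- v"] assms by auto
  qed
  moreover have "dim (rotate_pairs u (- v) ` ?W) = dim ?W"
    using linear_rotate_pairs inj by (intro dim_image_eq) (auto intro: inj_on_subset)
  ultimately show ?thesis by (simp only: dim_substandard_cart dim_vec_eq[symmetric])
qed

lemma embedded_imp_immersed:
  assumes "embedded_submanifold d M"
  shows "immersed_submanifold d M"
  unfolding immersed_submanifold_def
proof (intro exI conjI ballI)
  show "second_countable (top_of_set M)"
  proof (rule subset_second_countable)
    fix \<B> :: "'a set set"
    assume \<B>: "countable \<B>" "\<And>C. C \<in> \<B> \<Longrightarrow> openin (top_of_set M) C"
      and base: "\<And>T. openin (top_of_set M) T \<Longrightarrow> \<exists>\<U>. \<U> \<subseteq> \<B> \<and> T = \<Union>\<U>"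
    have "\<exists>C\<in>\<B>. x \<in> C \<and> C \<subseteq> T" if T: "openin (top_of_set M) T" "x \<in> T" for T x
    proof -
      obtain \<U> where "\<U> \<subseteq> \<B>" "T = \<Union>\<U>" using base[OF T(1)] by blast
      then show ?thesis using T(2) by blast
    qed
    then show ?thesis unfolding second_countable_def using \<B> by (intro exI[of _ \<B>]) simp
  qed
  fix p assume "p \<in> M"
  then show "p \<in> M" .
  show "openin (top_of_set M) M" by simp
  show "subtopology (top_of_set M) M = top_of_set M" by (simp add: subtopology_subtopology)
qed (use assms in auto)

lemma smooth_on_minus:
  assumes "open S" "smooth_on S f"
  shows "smooth_on S (\<lambda>x. - f x)"
  using assms(2) unfolding smooth_on_def
  by (blast intro: C_k_on_compose_bounded_linear[OF assms(1) bounded_linear_minus[OF bounded_linear_ident]])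

lemma smooth_on_ident: "smooth_on S (\<lambda>x. x)"
  by (rule smooth_on_bounded_linear[OF bounded_linear_ident])

lemma smooth_on_imp_continuous_on: "smooth_on S f \<Longrightarrow> continuous_on S f"
  unfolding smooth_on_def by (metis C_k_on.simps(1))

text \<open>
  Since \<open>g\<close> is constant along its own displacements, the maps \<open>x \<mapsto> x - g x\<close> and
  \<open>x \<mapsto> x + g x\<close> are inverse to each other. The first is a slice chart defined on the whole space, and
  the submanifold is the image of \<open>W\<close> under the second.
\<close>
lemma embedded_submanifold_shear:
  fixes g :: "'a::euclidean_space \<Rightarrow> 'a"
  assumes g: "smooth_on UNIV g" and shear: "\<And>x t. g (x + t *\<^sub>R g x) = g x"
    and W: "subspace W"
  shows "embedded_submanifold (dim W) {x. x - g x \<in> W}"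
proof -
  let ?\<phi> = "\<lambda>x. x - g x" and ?\<psi> = "\<lambda>x. x + g x"
  have inv: "?\<phi> (?\<psi> x) = x" "?\<psi> (?\<phi> x) = x" for x
    using shear[of x 1] shear[of x "- 1"] by simp_all
  have sm: "smooth_on UNIV ?\<phi>" "smooth_on UNIV ?\<psi>"
    using smooth_on_add[OF open_UNIV smooth_on_ident smooth_on_minus[OF open_UNIV g]]
      smooth_on_add[OF open_UNIV smooth_on_ident g] by simp_all
  have "homeomorphism UNIV UNIV ?\<phi> ?\<psi>"
    using inv sm by (intro homeomorphismI) (auto intro: smooth_on_imp_continuous_on)
  moreover have "?\<phi> ` (UNIV \<inter> {x. ?\<phi> x \<in> W}) = UNIV \<inter> W"
  proof (intro equalityI subsetI)
    fix w assume "w \<in> UNIV \<inter> W"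
    then have "w = ?\<phi> (?\<psi> w)" "?\<psi> w \<in> UNIV \<inter> {x. ?\<phi> x \<in> W}" using inv(1)[of w] by simp_all
    then show "w \<in> ?\<phi> ` (UNIV \<inter> {x. ?\<phi> x \<in> W})" by (rule image_eqI)
  qed auto
  ultimately show ?thesis
    unfolding embedded_submanifold_def using sm W
    by (intro ballI exI[of _ UNIV] exI[of _ ?\<phi>] exI[of _ ?\<psi>] exI[of _ W]) simp
qed

text \<open>
  The form in which orbits are presented: \<open>W\<close> is cut out by the vanishing of some rotated
  coordinates, so that its dimension is the number of the others.
\<close>
lemma immersed_submanifold_shear_rotate:
  assumes "u\<^sup>2 + v\<^sup>2 = 1" "smooth_on UNIV g" "\<And>x t. g (x + t *\<^sub>R g x) = g x"
  shows "immersed_submanifold (card I) {x. \<forall>i. i \<notin> I \<longrightarrow> rotate_pairs u v (x - g x) $ i = 0}"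
proof -
  let ?W = "{w. \<forall>i. i \<notin> I \<longrightarrow> rotate_pairs u v w $ i = 0}"
  have "subspace ?W"
    by (simp add: subspace_def linear_0[OF linear_rotate_pairs] linear_add[OF linear_rotate_pairs]
        linear_cmul[OF linear_rotate_pairs])
  with assms(2,3) have "embedded_submanifold (dim ?W) {x. x - g x \<in> ?W}"
    by (rule embedded_submanifold_shear[of g ?W])
  then show ?thesis
    unfolding dim_rotate_pairs_vimage[OF assms(1)] mem_Collect_eq by (rule embedded_imp_immersed)
qed

lemma smooth_on_nth: "smooth_on S (\<lambda>x. x $ i)"
  by (rule smooth_on_bounded_linear[OF bounded_linear_vec_nth])

lemma smooth_on_power:
  fixes f :: "'a::euclidean_space \<Rightarrow> real"
  assumes "open S" "smooth_on S f"
  shows "smooth_on S (\<lambda>x. f x ^ n)"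
  by (induction n) (simp_all add: smooth_on_const smooth_on_mult[OF assms])

lemmas smooth_intros = smooth_on_add smooth_on_diff smooth_on_mult smooth_on_divide_const
  smooth_on_power smooth_on_nth smooth_on_const open_UNIV

section \<open>The orbits as explicit sets\<close>

lemma flow_in_orbit:
  assumes "y \<in> orbit coadjoint_fields x"
  shows "flow V1 t y \<in> orbit coadjoint_fields x"
    "flow V2 t y \<in> orbit coadjoint_fields x"
    "flow V3 t y \<in> orbit coadjoint_fields x"
    "flow V4 t y \<in> orbit coadjoint_fields x"
    "flow V5 t y \<in> orbit coadjoint_fields x"
  using assms by (auto intro: orbit_flow)

lemma coadjoint_fields_cases:
  assumes "V \<in> coadjoint_fields" "P V1" "P V2" "P V3" "P V4" "P V5"
  shows "P V"
  using assms by auto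

lemma solve_2x2:
  fixes p q r s c d :: real
  assumes "p * s - q * r \<noteq> 0"
  obtains a b where "p * a + q * b = c" "r * a + s * b = d"
proof
  show "p * ((s * c - q * d) / (p * s - q * r)) + q * ((p * d - r * c) / (p * s - q * r)) = c"
    "r * ((s * c - q * d) / (p * s - q * r)) + s * ((p * d - r * c) / (p * s - q * r)) = d"
    using assms by (simp_all add: divide_simps) (simp_all add: algebra_simps)
qed

text \<open>
  This polynomial is constant on every co-adjoint orbit. Its coefficient of \<open>h\<^sub>3\<close> is \<open>- 2 \<Delta>\<close>, so
  for \<open>\<Delta> \<noteq> 0\<close> its level sets are graphs.
\<close>
definition casimir :: "real^8 \<Rightarrow> real" where
  "casimir x = (x$5)\<^sup>2 * x$6 - 2 * x$4 * x$5 * x$7 + (x$4)\<^sup>2 * x$8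
     - 2 * x$3 * (x$6 * x$8 - (x$7)\<^sup>2)"

lemma casimir_flow:
  assumes "V \<in> coadjoint_fields"
  shows "casimir (flow V t x) = casimir x"
  using assms by (rule coadjoint_fields_cases)
    (simp_all add: casimir_def flow_fields field_simps power2_eq_square)

lemma flow_nth_678:
  assumes "V \<in> coadjoint_fields" "i \<in> {6, 7, 8}"
  shows "flow V t x $ i = x $ i"
  using assms(1) by (rule coadjoint_fields_cases) (use assms(2) in \<open>auto simp: flow_fields\<close>)

text \<open>
  For \<open>\<Delta> \<noteq> 0\<close> the vectors \<open>(h\<^sub>6, h\<^sub>7)\<close> and \<open>(h\<^sub>7, h\<^sub>8)\<close> span the plane, so the flows of \<open>V1, V2\<close> reach
  every \<open>(h\<^sub>4, h\<^sub>5)\<close> and then those of \<open>V4, V5\<close> every \<open>(h\<^sub>1, h\<^sub>2)\<close>. There is no freedom left in \<open>h\<^sub>3\<close>, which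
  the Casimir polynomial fixes.
\<close>
lemma orbit_nondegenerate:
  assumes \<Delta>: "h$6 * h$8 - (h$7)\<^sup>2 \<noteq> 0"
  shows "orbit coadjoint_fields h =
    {x. x$6 = h$6 \<and> x$7 = h$7 \<and> x$8 = h$8 \<and> casimir x = casimir h}" (is "_ = ?S")
proof (rule orbit_eqI)
  show "flow V t y \<in> ?S" if "y \<in> ?S" "V \<in> coadjoint_fields" for y V t
    using that by (simp add: casimir_flow flow_nth_678)
  have det: "h$6 * h$8 - h$7 * h$7 \<noteq> 0" using \<Delta> by (simp add: power2_eq_square)
  show "y \<in> orbit coadjoint_fields h" if y: "y \<in> ?S" for y
  proof -
    obtain a b where ab: "h$6 * a + h$7 * b = h$4 - y$4" "h$7 * a + h$8 * b = h$5 - y$5"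
      using solve_2x2[OF det] by blast
    define z where "z = flow V2 b (flow V1 a h)"
    have z678: "z$6 = h$6" "z$7 = h$7" "z$8 = h$8" and z: "casimir z = casimir h"
      by (simp_all add: z_def casimir_flow flow_nth_678)
    have z45: "z$4 = y$4" "z$5 = y$5"
      using ab by (simp_all add: z_def flow_V1 flow_V2 algebra_simps)
    have y678: "y$6 = h$6" "y$7 = h$7" "y$8 = h$8" and "casimir z = casimir y" using y z by simp_all
    then have z3: "z$3 = y$3"
      using \<Delta> unfolding casimir_def z678 z45 y678 by simp
    obtain c d where cd: "h$6 * c + h$7 * d = y$1 - z$1" "h$7 * c + h$8 * d = y$2 - z$2"
      using solve_2x2[OF det] by blast
    have "y = flow V5 d (flow V4 c z)"
      using y cd by (simp add: vec_eq_iff forall_8 flow_fields z678 z45 z3 algebra_simps)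
    then show ?thesis by (simp add: z_def flow_in_orbit orbit_refl)
  qed
qed simp

text \<open>
  When the matrix of \<open>h\<^sub>6, h\<^sub>7, h\<^sub>8\<close> has rank one, \<open>V1\<close> and \<open>V2\<close> both move \<open>(h\<^sub>4, h\<^sub>5)\<close> along its image
  \<open>(u, v)\<close>, so the transverse component of \<open>(h\<^sub>4, h\<^sub>5)\<close> is invariant. If it is nonzero, it is the
  speed at which \<open>v V1 - u V2\<close> moves \<open>h\<^sub>3\<close> while fixing \<open>(h\<^sub>4, h\<^sub>5)\<close>, and \<open>V3, V4, V5\<close> span the \<open>(h\<^sub>1, h\<^sub>2)\<close>-plane: the orbit is an affine subspace.
\<close>
lemma orbit_transverse:
  assumes uv: "u\<^sup>2 + v\<^sup>2 = 1" and s: "s \<noteq> 0"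
    and h: "h$6 = s * u\<^sup>2" "h$7 = s * u * v" "h$8 = s * v\<^sup>2"
    and I: "u * h$5 - v * h$4 \<noteq> 0"
  shows "orbit coadjoint_fields h =
    {x. x$6 = h$6 \<and> x$7 = h$7 \<and> x$8 = h$8 \<and> u * x$5 - v * x$4 = u * h$5 - v * h$4}" (is "_ = ?S")
proof (rule orbit_eqI)
  show "flow V t y \<in> ?S" if y: "y \<in> ?S" and V: "V \<in> coadjoint_fields" for y V t
    using V by (rule coadjoint_fields_cases)
      (use y h in \<open>simp_all add: flow_fields algebra_simps power2_eq_square\<close>)
  show "y \<in> orbit coadjoint_fields h" if y: "y \<in> ?S" for y
  proof -
    \<comment> \<open>Flowing along \<open>V1\<close> for the time \<open>u \<tau>\<close> and along \<open>V2\<close> for \<open>v \<tau>\<close> shifts \<open>(h\<^sub>4, h\<^sub>5)\<close> by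
      \<open>- s \<tau> (u, v)\<close>.\<close>
    define \<tau> where "\<tau> = (u * (h$4 - y$4) + v * (h$5 - y$5)) / s"
    define z where "z = flow V2 (v * \<tau>) (flow V1 (u * \<tau>) h)"
    \<comment> \<open>Flowing along \<open>V1\<close> for the time \<open>v \<sigma>\<close> and along \<open>V2\<close> for \<open>- u \<sigma>\<close>: the shifts of
      \<open>(h\<^sub>4, h\<^sub>5)\<close> cancel, and \<open>h\<^sub>3\<close> grows by \<open>\<sigma>\<close> times the transverse component.\<close>
    define \<sigma> where "\<sigma> = (y$3 - z$3) / (u * h$5 - v * h$4)"
    define w where "w = flow V2 (- u * \<sigma>) (flow V1 (v * \<sigma>) z)"
    have s\<tau>: "s * \<tau> = u * (h$4 - y$4) + v * (h$5 - y$5)" using s by (simp add: \<tau>_def)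
    have z678: "z$6 = h$6" "z$7 = h$7" "z$8 = h$8"
      by (simp_all add: z_def flow_nth_678)
    have z45: "z$4 = y$4" "z$5 = y$5"
    proof -
      have "z$4 = h$4 - (u\<^sup>2 + v\<^sup>2) * u * (s * \<tau>)" "z$5 = h$5 - (u\<^sup>2 + v\<^sup>2) * v * (s * \<tau>)"
        by (simp_all add: z_def flow_fields h field_simps power2_eq_square)
      then show "z$4 = y$4" "z$5 = y$5"
        unfolding s\<tau> using uv y by (simp_all only: mem_Collect_eq) (algebra+)
    qed
    have w678: "w$6 = h$6" "w$7 = h$7" "w$8 = h$8"
      by (simp_all add: w_def flow_nth_678 z678)
    have w45: "w$4 = y$4" "w$5 = y$5"
      by (simp_all add: w_def flow_fields z45 z678 h power2_eq_square)
    have "w$3 = z$3 + \<sigma> * (u * y$5 - v * y$4)"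
      by (simp add: w_def flow_fields z45 z678 h field_simps power2_eq_square)
    then have w3: "w$3 = y$3" using I y by (simp add: \<sigma>_def)
    have "y$4 * (s * v) - (s * u) * y$5 \<noteq> 0" using I y s by (simp add: algebra_simps)
    then obtain c d where cd: "y$4 * c + (s * u) * d = y$1 - w$1" "y$5 * c + (s * v) * d = y$2 - w$2"
      using solve_2x2 by blast
    have "flow V5 (v * d) (flow V4 (u * d) (flow V3 c w)) $ 1 = w$1 + (y$4 * c + (u\<^sup>2 + v\<^sup>2) * ((s * u) * d))"
      "flow V5 (v * d) (flow V4 (u * d) (flow V3 c w)) $ 2 = w$2 + (y$5 * c + (u\<^sup>2 + v\<^sup>2) * ((s * v) * d))"
      by (simp_all add: flow_fields w45 w678 h algebra_simps power2_eq_square)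
    then have "y = flow V5 (v * d) (flow V4 (u * d) (flow V3 c w))"
      unfolding vec_eq_iff forall_8 uv mult_1 cd
      using y by (simp add: flow_fields w678 w45 w3)
    then show ?thesis by (simp add: z_def w_def flow_in_orbit orbit_refl)
  qed
qed simp

text \<open>
  Here \<open>(h\<^sub>4, h\<^sub>5) = \<rho> (u, v)\<close> along the whole orbit. With \<open>L = v h\<^sub>1 - u h\<^sub>2\<close>, a combination
  \<open>a V1 + b V2\<close> changes \<open>\<rho>, h\<^sub>3, L\<close> at the rates \<open>- s \<kappa>, - \<rho> \<kappa>, h\<^sub>3 \<kappa>\<close> where \<open>\<kappa> = a u + b v\<close>, while
  \<open>V3, V4, V5\<close> move \<open>(h\<^sub>1, h\<^sub>2)\<close> along \<open>(u, v)\<close> and leave \<open>L\<close> fixed. Integrating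
  \<open>dh\<^sub>3/d\<rho> = \<rho>/s\<close> and \<open>dL/d\<rho> = - h\<^sub>3/s\<close> gives the two polynomial invariants.
\<close>
lemma orbit_parallel:
  assumes uv: "u\<^sup>2 + v\<^sup>2 = 1" and s: "s \<noteq> 0"
    and h: "h$6 = s * u\<^sup>2" "h$7 = s * u * v" "h$8 = s * v\<^sup>2" "h$4 = r * u" "h$5 = r * v"
  shows "orbit coadjoint_fields h =
    {x. x$6 = h$6 \<and> x$7 = h$7 \<and> x$8 = h$8 \<and> (\<exists>\<rho>. x$4 = \<rho> * u \<and> x$5 = \<rho> * v \<and>
       2 * s * x$3 - \<rho>\<^sup>2 = 2 * s * h$3 - r\<^sup>2 \<and>
       3 * s\<^sup>2 * (v * x$1 - u * x$2) + 3 * s * x$3 * \<rho> - \<rho>^3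
         = 3 * s\<^sup>2 * (v * h$1 - u * h$2) + 3 * s * h$3 * r - r^3)}" (is "_ = ?S")
proof (rule orbit_eqI)
  show hS: "h \<in> ?S" using h by auto
  show inv: "flow V t y \<in> ?S" if y: "y \<in> ?S" and V: "V \<in> coadjoint_fields" for y V t
  proof -
    obtain \<rho> where \<rho>: "y$6 = s * u\<^sup>2" "y$7 = s * u * v" "y$8 = s * v\<^sup>2" "y$4 = \<rho> * u" "y$5 = \<rho> * v"
       "2 * s * y$3 - \<rho>\<^sup>2 = 2 * s * h$3 - r\<^sup>2"
       "3 * s\<^sup>2 * (v * y$1 - u * y$2) + 3 * s * y$3 * \<rho> - \<rho>^3
         = 3 * s\<^sup>2 * (v * h$1 - u * h$2) + 3 * s * h$3 * r - r^3"
      using y h by auto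
    have inS: "x \<in> ?S" if "x$6 = y$6 \<and> x$7 = y$7 \<and> x$8 = y$8 \<and> x$4 = \<rho>' * u \<and> x$5 = \<rho>' * v"
      "2 * s * x$3 - \<rho>'\<^sup>2 = 2 * s * y$3 - \<rho>\<^sup>2"
      "3 * s\<^sup>2 * (v * x$1 - u * x$2) + 3 * s * x$3 * \<rho>' - \<rho>'^3
         = 3 * s\<^sup>2 * (v * y$1 - u * y$2) + 3 * s * y$3 * \<rho> - \<rho>^3" for x \<rho>'
      using that \<rho> h by (auto intro!: exI[of _ \<rho>'])
    have "flow V1 t y \<in> ?S"
      by (rule inS[of _ "\<rho> - s * u * t"])
        (simp_all add: flow_fields \<rho>(1-5) field_simps power2_eq_square power3_eq_cube)
    moreover have "flow V2 t y \<in> ?S"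
      by (rule inS[of _ "\<rho> - s * v * t"])
        (simp_all add: flow_fields \<rho>(1-5) field_simps power2_eq_square power3_eq_cube)
    moreover have "flow V3 t y \<in> ?S" "flow V4 t y \<in> ?S" "flow V5 t y \<in> ?S"
      by (rule inS[of _ \<rho>]; simp add: flow_fields \<rho>(1-5) algebra_simps power2_eq_square)+
    ultimately show ?thesis using V by blast
  qed
  show "y \<in> orbit coadjoint_fields h" if y: "y \<in> ?S" for y
  proof -
    let ?L = "\<lambda>x::real^8. v * x$1 - u * x$2"
    obtain \<rho> where \<rho>: "y$6 = s * u\<^sup>2" "y$7 = s * u * v" "y$8 = s * v\<^sup>2" "y$4 = \<rho> * u" "y$5 = \<rho> * v"
       "2 * s * y$3 - \<rho>\<^sup>2 = 2 * s * h$3 - r\<^sup>2"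
       "3 * s\<^sup>2 * ?L y + 3 * s * y$3 * \<rho> - \<rho>^3 = 3 * s\<^sup>2 * ?L h + 3 * s * h$3 * r - r^3"
      using y h by auto
    \<comment> \<open>Once \<open>\<rho>\<close> has been adjusted, the invariants force \<open>h\<^sub>3\<close> and \<open>L\<close> to agree as well.\<close>
    define \<tau> where "\<tau> = (r - \<rho>) / s"
    have r: "r = \<rho> + s * \<tau>" using s by (simp add: \<tau>_def)
    define z where "z = flow V2 (v * \<tau>) (flow V1 (u * \<tau>) h)"
    have z: "z \<in> orbit coadjoint_fields h" by (simp add: z_def flow_in_orbit orbit_refl)
    have z678: "z$6 = s * u\<^sup>2" "z$7 = s * u * v" "z$8 = s * v\<^sup>2"
      by (simp_all add: z_def flow_nth_678 h)
    have "z$4 = r * u - (u\<^sup>2 + v\<^sup>2) * u * (s * \<tau>)" "z$5 = r * v - (u\<^sup>2 + v\<^sup>2) * v * (s * \<tau>)"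
      by (simp_all add: z_def flow_fields h field_simps power2_eq_square)
    then have z45: "z$4 = \<rho> * u" "z$5 = \<rho> * v" unfolding uv r by (simp_all add: algebra_simps)
    have "z \<in> ?S" unfolding z_def by (intro inv hS) simp_all
    then obtain \<rho>' where \<rho>': "z$4 = \<rho>' * u" "z$5 = \<rho>' * v" "2 * s * z$3 - \<rho>'\<^sup>2 = 2 * s * h$3 - r\<^sup>2"
       "3 * s\<^sup>2 * ?L z + 3 * s * z$3 * \<rho>' - \<rho>'^3 = 3 * s\<^sup>2 * ?L h + 3 * s * h$3 * r - r^3"
      by auto
    have "u \<noteq> 0 \<or> v \<noteq> 0" using uv by auto
    then have "\<rho>' = \<rho>" using z45 \<rho>' by auto
    then have "2 * s * z$3 = 2 * s * y$3" using \<rho>'(3) \<rho>(6) unfolding \<open>\<rho>' = \<rho>\<close> by linarith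
    then have z3: "z$3 = y$3" using s by simp
    have "3 * s\<^sup>2 * ?L z = 3 * s\<^sup>2 * ?L y"
      using \<rho>'(4) \<rho>(7) unfolding \<open>\<rho>' = \<rho>\<close> z3 by linarith
    then have "?L z = ?L y" using s by simp
    \<comment> \<open>The remaining difference lies along \<open>(u, v)\<close>, where \<open>u V4 + v V5\<close> acts with speed \<open>s\<close>.\<close>
    define \<beta> where "\<beta> = (u * (y$1 - z$1) + v * (y$2 - z$2)) / s"
    have s\<beta>: "s * \<beta> = u * (y$1 - z$1) + v * (y$2 - z$2)" using s by (simp add: \<beta>_def)
    let ?w = "flow V5 (v * \<beta>) (flow V4 (u * \<beta>) z)"
    have "?w $ 1 = z$1 + (u\<^sup>2 + v\<^sup>2) * u * (s * \<beta>)" "?w $ 2 = z$2 + (u\<^sup>2 + v\<^sup>2) * v * (s * \<beta>)"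
      by (simp_all add: flow_fields z678 algebra_simps power2_eq_square)
    then have "?w $ 1 = y $ 1" "?w $ 2 = y $ 2"
      unfolding s\<beta> using uv \<open>?L z = ?L y\<close> by algebra+
    moreover have "?w $ i = y $ i" if "i \<in> {3,4,5,6,7,8}" for i
      using that \<rho> z3 z45 z678 by (auto simp: flow_fields)
    ultimately have "y = ?w" by (simp add: vec_eq_iff forall_8)
    then show ?thesis using z by (simp add: flow_in_orbit)
  qed
qed

text \<open>
  With \<open>h\<^sub>6 = h\<^sub>7 = h\<^sub>8 = 0\<close> the coordinates \<open>(h\<^sub>4, h\<^sub>5) = r (u, v)\<close> are fixed. In the notation
  \<open>L = v h\<^sub>1 - u h\<^sub>2\<close>, a combination \<open>a V1 + b V2\<close> changes \<open>h\<^sub>3\<close> and \<open>L\<close> at the rates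
  \<open>- r \<kappa>\<close> and \<open>h\<^sub>3 \<kappa>\<close> with \<open>\<kappa> = a u + b v\<close>, whence the invariant \<open>2 r L + h\<^sub>3\<^sup>2\<close>; \<open>V3\<close> moves
  \<open>(h\<^sub>1, h\<^sub>2)\<close> along \<open>(u, v)\<close>.
\<close>
lemma orbit_step_three:
  assumes uv: "u\<^sup>2 + v\<^sup>2 = 1" and r: "r \<noteq> 0"
    and h: "h$6 = 0" "h$7 = 0" "h$8 = 0" "h$4 = r * u" "h$5 = r * v"
  shows "orbit coadjoint_fields h =
    {x. x$4 = h$4 \<and> x$5 = h$5 \<and> x$6 = 0 \<and> x$7 = 0 \<and> x$8 = 0 \<and>
       2 * r * (v * x$1 - u * x$2) + (x$3)\<^sup>2 = 2 * r * (v * h$1 - u * h$2) + (h$3)\<^sup>2}" (is "_ = ?S")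
proof (rule orbit_eqI)
  show "h \<in> ?S" using h by auto
  show "flow V t y \<in> ?S" if y: "y \<in> ?S" and V: "V \<in> coadjoint_fields" for y V t
    using V by (rule coadjoint_fields_cases)
      (use y h in \<open>simp_all add: flow_fields field_simps power2_eq_square\<close>)
  show "y \<in> orbit coadjoint_fields h" if y: "y \<in> ?S" for y
  proof -
    let ?L = "\<lambda>x::real^8. v * x$1 - u * x$2"
    define \<tau> where "\<tau> = (h$3 - y$3) / r"
    have r\<tau>: "r * \<tau> = h$3 - y$3" using r by (simp add: \<tau>_def)
    define z where "z = flow V2 (v * \<tau>) (flow V1 (u * \<tau>) h)"
    have z: "z \<in> orbit coadjoint_fields h" by (simp add: z_def flow_in_orbit orbit_refl)
    have z45678: "z$4 = r * u" "z$5 = r * v" "z$6 = 0" "z$7 = 0" "z$8 = 0"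
      by (simp_all add: z_def flow_fields h)
    have "z$3 = h$3 - (u\<^sup>2 + v\<^sup>2) * (r * \<tau>)"
      by (simp add: z_def flow_fields h algebra_simps power2_eq_square)
    then have z3: "z$3 = y$3" unfolding uv r\<tau> by simp
    have "2 * r * ?L z + (z$3)\<^sup>2 = 2 * r * ?L h + (h$3)\<^sup>2"
      by (simp add: z_def flow_fields h field_simps power2_eq_square)
    moreover have "2 * r * ?L y + (y$3)\<^sup>2 = 2 * r * ?L h + (h$3)\<^sup>2" using y by simp
    ultimately have "2 * r * ?L z = 2 * r * ?L y" unfolding z3 by linarith
    then have L: "?L z = ?L y" using r by simp
    define \<beta> where "\<beta> = (u * (y$1 - z$1) + v * (y$2 - z$2)) / r"
    have r\<beta>: "r * \<beta> = u * (y$1 - z$1) + v * (y$2 - z$2)" using r by (simp add: \<beta>_def)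
    let ?w = "flow V3 \<beta> z"
    have "?w $ 1 = z$1 + u * (r * \<beta>)" "?w $ 2 = z$2 + v * (r * \<beta>)"
      by (simp_all add: flow_fields z45678 algebra_simps power2_eq_square)
    then have "?w $ 1 = y $ 1" "?w $ 2 = y $ 2"
      unfolding r\<beta> using uv L by algebra+
    moreover have "?w $ i = y $ i" if "i \<in> {3,4,5,6,7,8}" for i
      using that y z3 z45678 h by (auto simp: flow_fields)
    ultimately have "y = ?w" by (simp add: vec_eq_iff forall_8)
    then show ?thesis using z by (simp add: flow_in_orbit)
  qed
qed

text \<open>
  The functional factors through the Heisenberg quotient, on which \<open>V1, V2\<close> act as translations
  of the \<open>(h\<^sub>1, h\<^sub>2)\<close>-plane with speed proportional to \<open>h\<^sub>3\<close>.
\<close>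
lemma orbit_step_two:
  assumes "h$3 \<noteq> 0" and h: "\<forall>i\<in>{4,5,6,7,8}. h$i = 0"
  shows "orbit coadjoint_fields h = {x. \<forall>i\<in>{3,4,5,6,7,8}. x$i = h$i}" (is "_ = ?S")
proof (rule orbit_eqI)
  show "flow V t y \<in> ?S" if y: "y \<in> ?S" and V: "V \<in> coadjoint_fields" for y V t
    using V by (rule coadjoint_fields_cases) (use y h in \<open>simp_all add: flow_fields\<close>)
  show "y \<in> orbit coadjoint_fields h" if y: "y \<in> ?S" for y
  proof -
    have "y = flow V2 ((y$1 - h$1) / h$3) (flow V1 ((h$2 - y$2) / h$3) h)"
      using y assms by (simp add: vec_eq_iff forall_8 flow_fields)
    then show ?thesis by (metis flow_in_orbit(1,2) orbit_refl)
  qed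
qed simp

lemma orbit_fixed_point:
  assumes h: "\<forall>i\<in>{3,4,5,6,7,8}. h$i = 0"
  shows "orbit coadjoint_fields h = {h}"
proof (rule orbit_eqI)
  show "flow V t y \<in> {h}" if y: "y \<in> {h}" and V: "V \<in> coadjoint_fields" for y V t
    using V by (rule coadjoint_fields_cases)
      (use y h in \<open>simp_all add: flow_fields vec_eq_iff forall_8\<close>)
qed (simp_all add: orbit_refl)

section \<open>Dimensions of the orbits\<close>

lemma casimir_eq_iff_nth_3:
  assumes "x$6 * x$8 - (x$7)\<^sup>2 \<noteq> 0"
  shows "casimir x = c \<longleftrightarrow>
    x$3 = (x$6 * (x$5)\<^sup>2 - 2 * x$7 * x$4 * x$5 + x$8 * (x$4)\<^sup>2 - c) / (2 * (x$6 * x$8 - (x$7)\<^sup>2))"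
  using assms by (subst eq_divide_eq) (auto simp: casimir_def algebra_simps)

text \<open>
  The orbit is a graph over the coordinates \<open>h\<^sub>1, h\<^sub>2, h\<^sub>4, h\<^sub>5\<close>.
\<close>
lemma immersed_orbit_nondegenerate:
  assumes \<Delta>: "h$6 * h$8 - (h$7)\<^sup>2 \<noteq> 0"
  shows "immersed_submanifold 4 (orbit coadjoint_fields h)"
proof -
  let ?\<Delta> = "h$6 * h$8 - (h$7)\<^sup>2"
  define g :: "real^8 \<Rightarrow> real^8" where
    "g x = (\<chi> i. if i = 3 then (h$6 * (x$5)\<^sup>2 - 2 * h$7 * x$4 * x$5 + h$8 * (x$4)\<^sup>2 - casimir h) / (2 * ?\<Delta>)
       else if i \<in> {6, 7, 8} then h$i else 0)" for x
  have "smooth_on UNIV g"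
  proof (rule smooth_on_vec[OF open_UNIV])
    show "smooth_on UNIV (\<lambda>x. g x $ i)" for i
      using exhaust_8[of i] by (elim disjE) (simp_all add: g_def smooth_on_const, (intro smooth_intros)+)
  qed
  moreover have "g (x + t *\<^sub>R g x) = g x" for x t
    by (simp add: g_def vec_eq_iff)
  ultimately have "immersed_submanifold (card {1, 2, 4, 5 :: 8})
      {x. \<forall>i. i \<notin> {1, 2, 4, 5} \<longrightarrow> rotate_pairs 1 0 (x - g x) $ i = 0}"
    by (intro immersed_submanifold_shear_rotate[of 1 0 g]) auto
  also have "{x. \<forall>i. i \<notin> {1, 2, 4, 5} \<longrightarrow> rotate_pairs 1 0 (x - g x) $ i = 0}
      = orbit coadjoint_fields h"
  proof -
    have "casimir x = casimir h \<longleftrightarrow> x$3 = g x $ 3" if "x$6 = h$6" "x$7 = h$7" "x$8 = h$8" for x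
      using casimir_eq_iff_nth_3[of x "casimir h"] \<Delta> unfolding that by (simp add: g_def)
    then show ?thesis
      unfolding orbit_nondegenerate[OF \<Delta>]
      by (auto simp: forall_8 rotate_pairs_def) (auto simp: g_def)
  qed
  finally show ?thesis by (simp add: numeral_eq_Suc)
qed

text \<open>
  The orbit is \<open>h\<close> plus a linear subspace, so the shear is constant.
\<close>
lemma immersed_orbit_transverse:
  assumes "u\<^sup>2 + v\<^sup>2 = 1" "s \<noteq> 0" "h$6 = s * u\<^sup>2" "h$7 = s * u * v" "h$8 = s * v\<^sup>2"
    and "u * h$5 - v * h$4 \<noteq> 0"
  shows "immersed_submanifold 4 (orbit coadjoint_fields h)"
proof -
  have "immersed_submanifold (card {1, 2, 3, 4 :: 8})
      {x. \<forall>i. i \<notin> {1, 2, 3, 4} \<longrightarrow> rotate_pairs u v (x - h) $ i = 0}"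
    by (rule immersed_submanifold_shear_rotate[OF assms(1) smooth_on_const]) simp
  also have "{x. \<forall>i. i \<notin> {1, 2, 3, 4} \<longrightarrow> rotate_pairs u v (x - h) $ i = 0} = orbit coadjoint_fields h"
    unfolding orbit_transverse[OF assms] by (auto simp: forall_8 rotate_pairs_def algebra_simps)
  finally show ?thesis by (simp add: numeral_eq_Suc)
qed

text \<open>
  Solved for \<open>h\<^sub>3\<close> and then for \<open>L\<close>, the two invariants make the orbit a graph over the components of
  \<open>(h\<^sub>1, h\<^sub>2)\<close> and \<open>(h\<^sub>4, h\<^sub>5)\<close> along \<open>(u, v)\<close>. The component \<open>\<rho>\<close>, on which the shear depends, is not
  changed by it.
\<close>
lemma immersed_orbit_parallel:
  assumes uv: "u\<^sup>2 + v\<^sup>2 = 1" and s: "s \<noteq> 0"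
    and h: "h$6 = s * u\<^sup>2" "h$7 = s * u * v" "h$8 = s * v\<^sup>2" "h$4 = r * u" "h$5 = r * v"
  shows "immersed_submanifold 2 (orbit coadjoint_fields h)"
proof -
  define K where "K = 2 * s * h$3 - r\<^sup>2"
  define M where "M = 3 * s\<^sup>2 * (v * h$1 - u * h$2) + 3 * s * h$3 * r - r^3"
  define \<rho> :: "real^8 \<Rightarrow> real" where "\<rho> x = u * x$4 + v * x$5" for x
  define \<alpha> where "\<alpha> x = (K + (\<rho> x)\<^sup>2) / (2 * s)" for x
  define \<beta> where "\<beta> x = (M - 3 * s * \<alpha> x * \<rho> x + (\<rho> x)^3) / (3 * s\<^sup>2)" for x
  define g :: "real^8 \<Rightarrow> real^8" where
    "g x = (\<chi> i. if i = 1 then v * \<beta> x else if i = 2 then - u * \<beta> x else if i = 3 then \<alpha> x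
       else if i \<in> {6, 7, 8} then h$i else 0)" for x
  have sm_\<rho>: "smooth_on UNIV \<rho>" unfolding \<rho>_def by (intro smooth_intros)
  have sm_\<alpha>: "smooth_on UNIV \<alpha>" unfolding \<alpha>_def by (intro smooth_intros sm_\<rho>)
  have sm_\<beta>: "smooth_on UNIV \<beta>" unfolding \<beta>_def by (intro smooth_intros sm_\<rho> sm_\<alpha>)
  have sm: "smooth_on UNIV g"
  proof (rule smooth_on_vec[OF open_UNIV])
    show "smooth_on UNIV (\<lambda>x. g x $ i)" for i
      using exhaust_8[of i] sm_\<alpha> smooth_on_mult[OF open_UNIV smooth_on_const sm_\<beta>, of v]
        smooth_on_mult[OF open_UNIV smooth_on_const sm_\<beta>, of "- u"]
      by (elim disjE) (simp_all add: g_def smooth_on_const)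
  qed
  have \<rho>_g: "\<rho> (x + t *\<^sub>R g x) = \<rho> x" for x t
    by (simp add: \<rho>_def g_def)
  have g_cong: "g y = g x" if "\<alpha> y = \<alpha> x" "\<beta> y = \<beta> x" for x y
    unfolding g_def that ..
  have shear: "g (x + t *\<^sub>R g x) = g x" for x t
  proof -
    have "\<alpha> (x + t *\<^sub>R g x) = \<alpha> x" "\<beta> (x + t *\<^sub>R g x) = \<beta> x"
      by (simp_all add: \<alpha>_def \<beta>_def \<rho>_g)
    then show ?thesis by (rule g_cong)
  qed
  have "immersed_submanifold (card {1, 4 :: 8})
      {x. \<forall>i. i \<notin> {1, 4} \<longrightarrow> rotate_pairs u v (x - g x) $ i = 0}"
    by (rule immersed_submanifold_shear_rotate[of u v g, OF uv sm shear])
  also have "{x. \<forall>i. i \<notin> {1, 4} \<longrightarrow> rotate_pairs u v (x - g x) $ i = 0} = orbit coadjoint_fields h"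
    (is "?G = _")
  proof -
    have "x \<in> ?G \<longleftrightarrow> x \<in> orbit coadjoint_fields h" for x
    proof -
      have "x \<in> ?G \<longleftrightarrow> v * x$1 - u * x$2 = (u\<^sup>2 + v\<^sup>2) * \<beta> x \<and> x$3 = \<alpha> x \<and> u * x$5 = v * x$4 \<and>
          x$6 = h$6 \<and> x$7 = h$7 \<and> x$8 = h$8"
        by (auto simp: forall_8 rotate_pairs_def g_def algebra_simps power2_eq_square)
      also have "\<dots> \<longleftrightarrow> x$6 = h$6 \<and> x$7 = h$7 \<and> x$8 = h$8 \<and> u * x$5 = v * x$4 \<and>
          2 * s * x$3 - (\<rho> x)\<^sup>2 = K \<and> 3 * s\<^sup>2 * (v * x$1 - u * x$2) + 3 * s * x$3 * \<rho> x - (\<rho> x)^3 = M"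
      proof -
        have 1: "x$3 = \<alpha> x \<longleftrightarrow> 2 * s * x$3 - (\<rho> x)\<^sup>2 = K"
          using s by (auto simp: \<alpha>_def field_simps)
        have 2: "v * x$1 - u * x$2 = \<beta> x \<longleftrightarrow>
            3 * s\<^sup>2 * (v * x$1 - u * x$2) + 3 * s * \<alpha> x * \<rho> x - (\<rho> x)^3 = M"
        proof -
          have "v * x$1 - u * x$2 = \<beta> x \<longleftrightarrow>
              (v * x$1 - u * x$2) * (3 * s\<^sup>2) = M - 3 * s * \<alpha> x * \<rho> x + (\<rho> x)^3"
            unfolding \<beta>_def using s by (subst eq_divide_eq) simp
          then show ?thesis by (auto simp: mult.commute)
        qed
        show ?thesis unfolding uv mult_1 2 using 1 by auto
      qed
      also have "\<dots> \<longleftrightarrow> x \<in> orbit coadjoint_fields h"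
      proof -
        have "u * x$5 = v * x$4 \<longleftrightarrow> x$4 = \<rho> x * u \<and> x$5 = \<rho> x * v"
          unfolding \<rho>_def using uv by algebra
        moreover have "\<rho> x = \<rho>'" if "x$4 = \<rho>' * u" "x$5 = \<rho>' * v" for \<rho>'
          unfolding \<rho>_def using uv that by algebra
        ultimately show ?thesis
          unfolding orbit_parallel[OF assms] K_def M_def mem_Collect_eq by metis
      qed
      finally show ?thesis .
    qed
    then show ?thesis by blast
  qed
  finally show ?thesis by (simp add: numeral_eq_Suc)
qed

text \<open>
  The invariant gives the transverse component of \<open>(h\<^sub>1, h\<^sub>2)\<close> as a function of \<open>h\<^sub>3\<close>, so that \<open>h\<^sub>3\<close> and
  the component along \<open>(u, v)\<close> are the parameters.
\<close>
lemma immersed_orbit_step_three: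
  assumes uv: "u\<^sup>2 + v\<^sup>2 = 1" and r: "r \<noteq> 0"
    and h: "h$6 = 0" "h$7 = 0" "h$8 = 0" "h$4 = r * u" "h$5 = r * v"
  shows "immersed_submanifold 2 (orbit coadjoint_fields h)"
proof -
  define K where "K = 2 * r * (v * h$1 - u * h$2) + (h$3)\<^sup>2"
  define \<beta> :: "real^8 \<Rightarrow> real" where "\<beta> x = (K - (x$3)\<^sup>2) / (2 * r)" for x
  define g :: "real^8 \<Rightarrow> real^8" where
    "g x = (\<chi> i. if i = 1 then v * \<beta> x else if i = 2 then - u * \<beta> x else if i \<in> {4, 5} then h$i else 0)" for x
  have sm_\<beta>: "smooth_on UNIV \<beta>" unfolding \<beta>_def by (intro smooth_intros)
  have sm: "smooth_on UNIV g"
  proof (rule smooth_on_vec[OF open_UNIV])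
    show "smooth_on UNIV (\<lambda>x. g x $ i)" for i
      using exhaust_8[of i] smooth_on_mult[OF open_UNIV smooth_on_const sm_\<beta>, of v]
        smooth_on_mult[OF open_UNIV smooth_on_const sm_\<beta>, of "- u"]
      by (elim disjE) (simp_all add: g_def smooth_on_const)
  qed
  have shear: "g (x + t *\<^sub>R g x) = g x" for x t
    by (simp add: g_def \<beta>_def vec_eq_iff)
  have "immersed_submanifold (card {1, 3 :: 8})
      {x. \<forall>i. i \<notin> {1, 3} \<longrightarrow> rotate_pairs u v (x - g x) $ i = 0}"
    by (rule immersed_submanifold_shear_rotate[of u v g, OF uv sm shear])
  also have "{x. \<forall>i. i \<notin> {1, 3} \<longrightarrow> rotate_pairs u v (x - g x) $ i = 0} = orbit coadjoint_fields h"
    (is "?G = _")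
  proof -
    have "x \<in> ?G \<longleftrightarrow> x \<in> orbit coadjoint_fields h" for x
    proof -
      have "x \<in> ?G \<longleftrightarrow> v * x$1 - u * x$2 = (u\<^sup>2 + v\<^sup>2) * \<beta> x \<and>
          (u * (x$4 - h$4) + v * (x$5 - h$5) = 0 \<and> u * (x$5 - h$5) = v * (x$4 - h$4)) \<and>
          x$6 = 0 \<and> x$7 = 0 \<and> x$8 = 0"
        by (auto simp: forall_8 rotate_pairs_def g_def algebra_simps power2_eq_square)
      also have "(u * (x$4 - h$4) + v * (x$5 - h$5) = 0 \<and> u * (x$5 - h$5) = v * (x$4 - h$4)) \<longleftrightarrow>
          x$4 = h$4 \<and> x$5 = h$5"
        using uv by algebra
      also have "v * x$1 - u * x$2 = (u\<^sup>2 + v\<^sup>2) * \<beta> x \<longleftrightarrow> 2 * r * (v * x$1 - u * x$2) + (x$3)\<^sup>2 = K"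
        unfolding uv \<beta>_def using r by (auto simp: field_simps)
      finally show ?thesis unfolding orbit_step_three[OF assms] K_def by auto
    qed
    then show ?thesis by blast
  qed
  finally show ?thesis by (simp add: numeral_eq_Suc)
qed

lemma immersed_orbit_step_two:
  assumes "h$3 \<noteq> 0" "\<forall>i\<in>{4,5,6,7,8}. h$i = 0"
  shows "immersed_submanifold 2 (orbit coadjoint_fields h)"
proof -
  have "immersed_submanifold (card {1, 2 :: 8})
      {x. \<forall>i. i \<notin> {1, 2} \<longrightarrow> rotate_pairs 1 0 (x - h) $ i = 0}"
    by (rule immersed_submanifold_shear_rotate[OF _ smooth_on_const]) simp_all
  also have "{x. \<forall>i. i \<notin> {1, 2} \<longrightarrow> rotate_pairs 1 0 (x - h) $ i = 0} = orbit coadjoint_fields h"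
    unfolding orbit_step_two[OF assms] by (auto simp: forall_8 rotate_pairs_def)
  finally show ?thesis by (simp add: numeral_eq_Suc)
qed

lemma immersed_orbit_fixed_point:
  assumes "\<forall>i\<in>{3,4,5,6,7,8}. h$i = 0"
  shows "immersed_submanifold 0 (orbit coadjoint_fields h)"
proof -
  have "immersed_submanifold (card ({} :: 8 set))
      {x. \<forall>i. i \<notin> {} \<longrightarrow> rotate_pairs 1 0 (x - h) $ i = 0}"
    by (rule immersed_submanifold_shear_rotate[OF _ smooth_on_const]) simp_all
  also have "{x. \<forall>i. i \<notin> {} \<longrightarrow> rotate_pairs 1 0 (x - h) $ i = 0} = orbit coadjoint_fields h"
    unfolding orbit_fixed_point[OF assms] by (auto simp: forall_8 rotate_pairs_def vec_eq_iff)
  finally show ?thesis by (simp add: numeral_eq_Suc)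
qed

section \<open>Singular symmetric matrices of order two\<close>

lemma unit_direction:
  fixes a b :: real
  assumes "a \<noteq> 0 \<or> b \<noteq> 0"
  obtains u v r where "u\<^sup>2 + v\<^sup>2 = 1" "r \<noteq> 0" "a = r * u" "b = r * v"
proof
  let ?r = "sqrt (a\<^sup>2 + b\<^sup>2)"
  have pos: "a\<^sup>2 + b\<^sup>2 > 0" using assms by (simp add: sum_power2_gt_zero_iff)
  then show r: "?r \<noteq> 0" by (metis less_irrefl real_sqrt_gt_0_iff)
  show "a = ?r * (a / ?r)" "b = ?r * (b / ?r)"
    by (simp_all only: times_divide_eq_right nonzero_mult_div_cancel_left[OF r])
  have "(a / ?r)\<^sup>2 + (b / ?r)\<^sup>2 = (a\<^sup>2 + b\<^sup>2) / ?r\<^sup>2"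
    by (simp only: power_divide add_divide_distrib)
  also have "?r\<^sup>2 = a\<^sup>2 + b\<^sup>2" using pos by simp
  also have "(a\<^sup>2 + b\<^sup>2) / (a\<^sup>2 + b\<^sup>2) = 1" using pos by (intro divide_self) linarith
  finally show "(a / ?r)\<^sup>2 + (b / ?r)\<^sup>2 = 1" .
qed

text \<open>
  A nonzero symmetric matrix \<open>(a b; b c)\<close> with zero determinant is a multiple of the projection
  onto the line of a nonzero row \<open>r (u, v)\<close>: if \<open>a \<noteq> 0\<close>, the first row is one and the determinant
  forces \<open>c\<close>; if \<open>a = 0\<close>, then \<open>b = 0\<close> too.
\<close>
lemma rank_one_symmetric:
  fixes a b c :: real
  assumes "a * c = b\<^sup>2" "a \<noteq> 0 \<or> b \<noteq> 0 \<or> c \<noteq> 0"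
  obtains u v s where "u\<^sup>2 + v\<^sup>2 = 1" "s \<noteq> 0" "a = s * u\<^sup>2" "b = s * u * v" "c = s * v\<^sup>2"
proof (cases "a = 0")
  case True
  then show ?thesis using that[of 0 1 c] assms by simp
next
  case False
  obtain u v r where uv: "u\<^sup>2 + v\<^sup>2 = 1" "r \<noteq> 0" "a = r * u" "b = r * v"
    using unit_direction[of a b] False by blast
  then have "u \<noteq> 0" using False by auto
  have "c = r / u * v\<^sup>2"
    using assms(1) uv(2) \<open>u \<noteq> 0\<close> unfolding uv(3,4) by (simp add: field_simps power2_eq_square)
  with \<open>u \<noteq> 0\<close> uv show ?thesis
    by (intro that[of u v "r / u"]) (simp_all add: power2_eq_square)
qed

section \<open>The orbits of the co-adjoint fields\<close>

theorem corollary1: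
  fixes h :: "real^8" and \<Delta> \<Delta>\<^sub>1 \<Delta>\<^sub>2 C :: real
  defines "\<Delta> \<equiv> h$6 * h$8 - (h$7)\<^sup>2"
    and "\<Delta>\<^sub>1 \<equiv> h$5 * h$7 - h$4 * h$8"
    and "\<Delta>\<^sub>2 \<equiv> h$5 * h$6 - h$4 * h$7"
    and "C \<equiv> (h$5)\<^sup>2 * h$6 - 2 * h$4 * h$5 * h$7 + (h$4)\<^sup>2 * h$8
               - 2 * h$3 * (h$6 * h$8 - (h$7)\<^sup>2)"
  shows
    "coadjoint_orbit h = orbit coadjoint_fields h
   \<and> (\<Delta>\<^sup>2 + \<Delta>\<^sub>1\<^sup>2 + \<Delta>\<^sub>2\<^sup>2 \<noteq> 0 \<longrightarrow> immersed_submanifold 4 (orbit coadjoint_fields h))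
   \<and> (\<Delta>\<^sup>2 + \<Delta>\<^sub>1\<^sup>2 + \<Delta>\<^sub>2\<^sup>2 = 0 \<and>
        (h$3)\<^sup>2 + (h$4)\<^sup>2 + (h$5)\<^sup>2 + (h$6)\<^sup>2 + (h$7)\<^sup>2 + (h$8)\<^sup>2 \<noteq> 0 \<longrightarrow>
        immersed_submanifold 2 (orbit coadjoint_fields h))
   \<and> ((h$3)\<^sup>2 + (h$4)\<^sup>2 + (h$5)\<^sup>2 + (h$6)\<^sup>2 + (h$7)\<^sup>2 + (h$8)\<^sup>2 = 0 \<longrightarrow>
        immersed_submanifold 0 (orbit coadjoint_fields h))
   \<and> (\<Delta> \<noteq> 0 \<longrightarrow>
        orbit coadjoint_fields h =
          {h' :: real^8. h'$6 = h$6 \<and> h'$7 = h$7 \<and> h'$8 = h$8 \<and>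
             h'$3 = (h$6 * (h'$5)\<^sup>2 - 2 * h$7 * h'$4 * h'$5 + h$8 * (h'$4)\<^sup>2 - C) / (2 * \<Delta>)})"
proof (intro conjI impI)
  show "coadjoint_orbit h = orbit coadjoint_fields h" by (rule coadjoint_orbit_eq_orbit)
next
  assume "\<Delta>\<^sup>2 + \<Delta>\<^sub>1\<^sup>2 + \<Delta>\<^sub>2\<^sup>2 \<noteq> 0"
  show "immersed_submanifold 4 (orbit coadjoint_fields h)"
  proof (cases "\<Delta> = 0")
    case False
    then show ?thesis unfolding \<Delta>_def by (rule immersed_orbit_nondegenerate)
  next
    case True
    with \<open>\<Delta>\<^sup>2 + \<Delta>\<^sub>1\<^sup>2 + \<Delta>\<^sub>2\<^sup>2 \<noteq> 0\<close> have \<Delta>12: "\<Delta>\<^sub>1 \<noteq> 0 \<or> \<Delta>\<^sub>2 \<noteq> 0" by auto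
    then have "h$6 \<noteq> 0 \<or> h$7 \<noteq> 0 \<or> h$8 \<noteq> 0" by (auto simp: \<Delta>\<^sub>1_def \<Delta>\<^sub>2_def)
    moreover have "h$6 * h$8 = (h$7)\<^sup>2" using True by (simp add: \<Delta>_def)
    ultimately obtain u v s where uvs: "u\<^sup>2 + v\<^sup>2 = 1" "s \<noteq> 0"
        "h$6 = s * u\<^sup>2" "h$7 = s * u * v" "h$8 = s * v\<^sup>2"
      using rank_one_symmetric by metis
    have "\<Delta>\<^sub>1 = s * v * (u * h$5 - v * h$4)" "\<Delta>\<^sub>2 = s * u * (u * h$5 - v * h$4)"
      by (simp_all add: \<Delta>\<^sub>1_def \<Delta>\<^sub>2_def uvs algebra_simps power2_eq_square)
    with \<Delta>12 have "u * h$5 - v * h$4 \<noteq> 0" by auto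
    with uvs show ?thesis by (rule immersed_orbit_transverse)
  qed
next
  assume *: "\<Delta>\<^sup>2 + \<Delta>\<^sub>1\<^sup>2 + \<Delta>\<^sub>2\<^sup>2 = 0 \<and>
    (h$3)\<^sup>2 + (h$4)\<^sup>2 + (h$5)\<^sup>2 + (h$6)\<^sup>2 + (h$7)\<^sup>2 + (h$8)\<^sup>2 \<noteq> 0"
  then have \<Delta>0: "\<Delta> = 0" "\<Delta>\<^sub>1 = 0" "\<Delta>\<^sub>2 = 0"
    by (auto simp: add_nonneg_eq_0_iff)
  consider "h$6 \<noteq> 0 \<or> h$7 \<noteq> 0 \<or> h$8 \<noteq> 0"
    | "h$6 = 0" "h$7 = 0" "h$8 = 0" "h$4 \<noteq> 0 \<or> h$5 \<noteq> 0"
    | "h$3 \<noteq> 0" "\<forall>i\<in>{4,5,6,7,8}. h$i = 0"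
    using * by (cases "h$4 = 0"; cases "h$5 = 0"; cases "h$6 = 0"; cases "h$7 = 0"; cases "h$8 = 0") auto
  then show "immersed_submanifold 2 (orbit coadjoint_fields h)"
  proof cases
    case 1
    moreover have "h$6 * h$8 = (h$7)\<^sup>2" using \<Delta>0 by (simp add: \<Delta>_def)
    ultimately obtain u v s where uvs: "u\<^sup>2 + v\<^sup>2 = 1" "s \<noteq> 0"
        "h$6 = s * u\<^sup>2" "h$7 = s * u * v" "h$8 = s * v\<^sup>2"
      using rank_one_symmetric by metis
    have "s * v * (u * h$5 - v * h$4) = 0" "s * u * (u * h$5 - v * h$4) = 0"
      using \<Delta>0(2,3) by (simp_all add: \<Delta>\<^sub>1_def \<Delta>\<^sub>2_def uvs algebra_simps power2_eq_square)
    moreover have "u \<noteq> 0 \<or> v \<noteq> 0" using uvs(1) by auto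
    ultimately have "u * h$5 = v * h$4" using uvs(2) by auto
    then have "h$4 = (u * h$4 + v * h$5) * u" "h$5 = (u * h$4 + v * h$5) * v"
      using uvs(1) by algebra+
    with uvs show ?thesis by (rule immersed_orbit_parallel)
  next
    case 2
    from 2(4) obtain u v r where uvr: "u\<^sup>2 + v\<^sup>2 = 1" "r \<noteq> 0" "h$4 = r * u" "h$5 = r * v"
      by (rule unit_direction)
    from uvr(1,2) 2(1-3) uvr(3,4) show ?thesis by (rule immersed_orbit_step_three)
  next
    case 3
    then show ?thesis by (rule immersed_orbit_step_two)
  qed
next
  assume "(h$3)\<^sup>2 + (h$4)\<^sup>2 + (h$5)\<^sup>2 + (h$6)\<^sup>2 + (h$7)\<^sup>2 + (h$8)\<^sup>2 = 0"
  then have "\<forall>i\<in>{3,4,5,6,7,8}. h$i = 0"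
    by (simp add: add_nonneg_eq_0_iff)
  then show "immersed_submanifold 0 (orbit coadjoint_fields h)"
    by (rule immersed_orbit_fixed_point)
next
  assume \<Delta>: "\<Delta> \<noteq> 0"
  have C: "casimir h = C" by (simp add: casimir_def C_def)
  have "casimir x = C \<longleftrightarrow>
      x$3 = (h$6 * (x$5)\<^sup>2 - 2 * h$7 * x$4 * x$5 + h$8 * (x$4)\<^sup>2 - C) / (2 * \<Delta>)"
    if "x$6 = h$6" "x$7 = h$7" "x$8 = h$8" for x
    using casimir_eq_iff_nth_3[of x C] \<Delta> unfolding \<Delta>_def that by simp
  then show "orbit coadjoint_fields h =
      {h' :: real^8. h'$6 = h$6 \<and> h'$7 = h$7 \<and> h'$8 = h$8 \<and>
         h'$3 = (h$6 * (h'$5)\<^sup>2 - 2 * h$7 * h'$4 * h'$5 + h$8 * (h'$4)\<^sup>2 - C) / (2 * \<Delta>)}"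
    unfolding orbit_nondegenerate[OF \<Delta>[unfolded \<Delta>_def]] C by blast
qed

end
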